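(* Let $A\colon\mathbb{R}\to M_n(\mathbb{R})$ and $f\colon\mathbb{R}\times\mathbb{R}^n\to\mathbb{R}^n$ be continuous. Consider $\dot x=A(t)x$, with transition matrix $X(t,s)$, and $\dot y=A(t)y+f(t,y)$, whose solution with value $\eta$ at time $\tau$ is denoted $t\mapsto y(t,\tau,\eta)$. Assume: (A1) $\sup_{t\in\mathbb{R}}\|A(t)\|=M<+\infty$; (A2) there is $\mu>0$ with $|f(t,y)|\le\mu$ for all $(t,y)\in\mathbb{R}\times\mathbb{R}^n$; (A3) there is $\gamma>0$ with $|f(t,y)-f(t,y')|\le\gamma|y-y'|$ for all $t\in\mathbb{R}$ and $y,y'\in\mathbb{R}^n$; (A4) $\dot x=A(t)x$ has an exponential dichotomy on $\mathbb{R}$ with projection $P=I$ and constants $K,\alpha>0$, that is, $\|X(t,s)\|\le Ke^{-\alpha(t-s)}$ for all $t\ge s$, and $2K\gamma<\alpha$; (D1) for each $t$ the map $y\mapsto f(t,y)$ is $C^2$, and for any fixed $t\in\mathbb{R}$ its first derivative $Df$ with respect to $y$ satisfies $$\int_{-\infty}^{t}\ \sup_{\xi\in\mathbb{R}^n}\|X(t,r)\,Df(r,y(r,0,\xi))\,X(r,t)\|\,dr<1;$$ (D2) for any fixed $t\in\mathbb{R}$ and any $\xi\in\mathbb{R}^n$, $\displaystyle\int_{-\infty}^{t}\mathrm{Tr}\,Df(r,y(r,t,\xi))\,dr<+\infty$; (D3) for any fixed $t\in\mathbb{R}$ and all $i,j\in\{1,\dots,n\}$, the limit $\displaystyle\lim_{s\to-\infty}\frac{\partial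 Z_\eta(s)}{\partial\eta_j}e_i$ exists, where $\eta=(\eta_1,\dots,\eta_n)$, $e_i$ is the $i$-th canonical basis vector of $\mathbb{R}^n$, and $Z_\eta(s)$ is the fundamental matrix, with $Z_\eta(t)=I$, of the $\eta$-dependent linear system $\dot z=F(s,\eta)z$ with $F(s,\eta)=X(t,s)\,Df(s,y(s,t,\eta))\,X(s,t)$. Define $$G(t,\eta)=\eta-\int_{-\infty}^{t}X(t,s)f(s,y(s,t,\eta))\,ds,\qquad (t,\eta)\in\mathbb{R}\times\mathbb{R}^n.$$ Then, for any fixed $t\in\mathbb{R}$, the map $\eta\mapsto G(t,\eta)$ is a $C^2$ orientation preserving diffeomorphism of $\mathbb{R}^n$.
   Context: $|\cdot|$ is a norm on $\mathbb{R}^n$ and $\|\cdot\|$ the induced operator norm. If $X(t)$ is a fundamental matrix of $\dot x=A(t)x$, the transition matrix is $X(t,s)=X(t)X^{-1}(s)$. Orientation preserving means that the Jacobian determinant is everywhere positive. The map $G$ is the homeomorphism (of Palmer's global linearization) sending solutions of the nonlinear system to solutions of the linear one.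
   Formalization: In (D3) the partial derivatives of Z_η(s) in η_j are assumed continuous in η for s near −∞ and their limit is assumed to exist uniformly on compact sets of η; with a limit merely for each η the claim fails (G need not be C²). *)

theory Defs
  imports "HOL-Analysis.Analysis"
begin

text \<open>An arbitrary norm on \<open>\<real>\<^sup>n\<close>, not necessarily the Euclidean one of the type class.\<close>

definition vector_norm :: "(real^'n \<Rightarrow> real) \<Rightarrow> bool" where
  "vector_norm N \<longleftrightarrow>
     (\<forall>x. 0 \<le> N x) \<and> (\<forall>x. N x = 0 \<longleftrightarrow> x = 0) \<and>
     (\<forall>c x. N (c *\<^sub>R x) = \<bar>c\<bar> * N x) \<and> (\<forall>x y. N (x + y) \<le> N x + N y)"

text \<open>As in \<^const>\<open>onorm\<close>, the term for \<open>x = 0\<close> is \<open>0 / 0 = 0\<close> and does not affect the supremum.\<close>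

definition op_norm :: "(real^'n \<Rightarrow> real) \<Rightarrow> real^'n^'n \<Rightarrow> real" where
  "op_norm N B = (SUP x. N (B *v x) / N x)"

definition fundamental_matrix :: "(real \<Rightarrow> real^'n^'n) \<Rightarrow> (real \<Rightarrow> real^'n^'n) \<Rightarrow> bool" where
  "fundamental_matrix A \<Phi> \<longleftrightarrow>
     (\<forall>t. (\<Phi> has_vector_derivative A t ** \<Phi> t) (at t)) \<and> (\<forall>t. invertible (\<Phi> t))"

text \<open>The same notion with the differential equation in integrated form. It coincides with
  \<^const>\<open>fundamental_matrix\<close> when the coefficient is continuous. It is used for
  \<open>z' = F(s,\<eta>) z\<close>: since \<open>f(t,\<cdot>)\<close> is only \<open>C\<^sup>2\<close> for each fixed \<open>t\<close>, the coefficient is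
  measurable and locally bounded in \<open>s\<close> but need not be continuous in \<open>s\<close>, so that an everywhere
  differentiable solution might not exist, whereas an integrated one always does.\<close>

definition fundamental_matrix_int :: "(real \<Rightarrow> real^'n^'n) \<Rightarrow> (real \<Rightarrow> real^'n^'n) \<Rightarrow> bool" where
  "fundamental_matrix_int F Z \<longleftrightarrow>
     (\<forall>a b. a \<le> b \<longrightarrow> ((\<lambda>r. F r ** Z r) has_integral (Z b - Z a)) {a..b}) \<and>
     (\<forall>s. invertible (Z s))"

definition transition_matrix :: "(real \<Rightarrow> real^'n^'n) \<Rightarrow> real \<Rightarrow> real \<Rightarrow> real^'n^'n" where
  "transition_matrix \<Phi> t s = \<Phi> t ** matrix_inv (\<Phi> s)"

definition general_solution ::
  "(real \<Rightarrow> real^'n^'n) \<Rightarrow> (real \<Rightarrow> real^'n \<Rightarrow> real^'n) \<Rightarrow> (real \<Rightarrow> real \<Rightarrow> real^'n \<Rightarrow> real^'n) \<Rightarrow> bool" where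
  "general_solution A f y \<longleftrightarrow>
     (\<forall>\<tau> \<eta>. y \<tau> \<tau> \<eta> = \<eta> \<and>
       (\<forall>t. ((\<lambda>t. y t \<tau> \<eta>) has_vector_derivative A t *v y t \<tau> \<eta> + f t (y t \<tau> \<eta>)) (at t)))"

definition C2 :: "('a::real_normed_vector \<Rightarrow> 'b::real_normed_vector) \<Rightarrow> bool" where
  "C2 g \<longleftrightarrow> (\<exists>(g' :: 'a \<Rightarrow> 'a \<Rightarrow>\<^sub>L 'b) (g'' :: 'a \<Rightarrow> 'a \<Rightarrow>\<^sub>L ('a \<Rightarrow>\<^sub>L 'b)).
     (\<forall>x. (g has_derivative blinfun_apply (g' x)) (at x)) \<and>
     (\<forall>x. (g' has_derivative blinfun_apply (g'' x)) (at x)) \<and>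
     continuous_on UNIV g'')"

definition C2_diffeomorphism :: "(real^'n \<Rightarrow> real^'n) \<Rightarrow> bool" where
  "C2_diffeomorphism g \<longleftrightarrow> bij g \<and> C2 g \<and> C2 (inv g)"

definition orientation_preserving :: "(real^'n \<Rightarrow> real^'n) \<Rightarrow> bool" where
  "orientation_preserving g \<longleftrightarrow> (\<forall>x. g differentiable (at x) \<and> 0 < det (jacobian g (at x)))"

definition Dy :: "(real \<Rightarrow> real^'n \<Rightarrow> real^'n) \<Rightarrow> real \<Rightarrow> real^'n \<Rightarrow> real^'n^'n" where
  "Dy f t x = jacobian (f t) (at x)"

definition has_partial :: "'n::finite \<Rightarrow> (real^'n \<Rightarrow> 'b::real_normed_vector) \<Rightarrow> real^'n \<Rightarrow> bool" where
  "has_partial j g \<eta> \<longleftrightarrow> (\<lambda>h. g (\<eta> + h *\<^sub>R axis j 1)) differentiable (at 0)"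

definition partial_deriv :: "'n::finite \<Rightarrow> (real^'n \<Rightarrow> 'b::real_normed_vector) \<Rightarrow> real^'n \<Rightarrow> 'b" where
  "partial_deriv j g \<eta> = vector_derivative (\<lambda>h. g (\<eta> + h *\<^sub>R axis j 1)) (at 0)"

text \<open>Lebesgue integral with values in the extended reals. By the convention \<open>\<infinity> - \<infinity> = \<infinity>\<close> of
  \<^typ>\<open>ereal\<close>, the value is \<open>< \<infinity>\<close> only if the integral is defined, in \<open>[-\<infinity>, \<infinity>)\<close>.\<close>

definition extended_integral :: "real set \<Rightarrow> (real \<Rightarrow> real) \<Rightarrow> ereal" where
  "extended_integral S g =
     enn2ereal (\<integral>\<^sup>+r\<in>S. ennreal (g r) \<partial>lborel) - enn2ereal (\<integral>\<^sup>+r\<in>S. ennreal (- g r) \<partial>lborel)"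

text \<open>Existence of \<open>lim\<^bsub>s \<rightarrow> -\<infinity>\<^esub> H s\<close> in the space of continuous functions of the parameter
  \<open>\<eta>\<close>, with its usual topology of uniform convergence on compact sets. For
  \<open>H s \<eta> = (\<partial>Z\<^sub>\<eta>(s) / \<partial>\<eta>\<^sub>j) e\<^sub>i\<close> this is what passing to the limit under \<open>\<partial>/\<partial>\<eta>\<^sub>j\<close> requires.
  Existence of the limit separately for each \<open>\<eta>\<close> does not suffice for a \<open>C\<^sup>2\<close> limit map:
  take \<open>n = 1\<close>, \<open>A = -1\<close>, \<open>f(s,y) = e\<^sup>-\<^sup>s h(s, e\<^sup>s y)\<close>, where \<open>w' = h(s,w)\<close> has the flow
  \<open>\<phi>\<^sub>s \<circ> \<phi>\<^sub>t\<inverse>\<close> with \<open>\<phi>\<^sub>s(w) = w + \<epsilon> \<integral> \<chi>(u) sqrt(u\<^sup>2 + m(s)) du\<close> over \<open>[0,w]\<close>, where \<open>\<chi>\<close> is a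
  smooth cut-off function, \<open>m(s) = e\<^sup>2\<^sup>s\<close> for \<open>s \<le> 0\<close> and \<open>m\<close> is constant for \<open>s \<ge> 1\<close>.\<close>

definition limit_in_C_at_bot :: "(real \<Rightarrow> real^'n \<Rightarrow> real^'n) \<Rightarrow> bool" where
  "limit_in_C_at_bot H \<longleftrightarrow>
     (\<forall>\<^sub>F s in at_bot. continuous_on UNIV (H s)) \<and>
     (\<exists>L. \<forall>C. compact C \<longrightarrow> uniform_limit C H L at_bot)"

definition linearizing_map ::
  "(real \<Rightarrow> real \<Rightarrow> real^'n^'n) \<Rightarrow> (real \<Rightarrow> real^'n \<Rightarrow> real^'n) \<Rightarrow>
   (real \<Rightarrow> real \<Rightarrow> real^'n \<Rightarrow> real^'n) \<Rightarrow> real \<Rightarrow> real^'n \<Rightarrow> real^'n" where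
  "linearizing_map X f y t \<eta> = \<eta> - (LINT s:{..t}|lborel. X t s *v f s (y s t \<eta>))"

end

theory Submission
  imports Defs
begin

text \<open>Fix \<open>t\<close> and put \<open>v(r,\<eta>) = X(t,r) y(r,t,\<eta>)\<close>. Then \<open>v' = g(r,v)\<close> with
  \<open>g(r,x) = X(t,r) f(r, X(r,t) x)\<close>, so \<open>v(s,\<eta>)\<close> tends to \<open>G(t,\<eta>)\<close> as \<open>s \<rightarrow> -\<infinity>\<close>, and (D1) says that the
  Lipschitz constants \<open>\<phi>(r)\<close> of \<open>g(r,\<cdot>)\<close> have integral less than one over \<open>(-\<infinity>,t]\<close>. Estimating
  suprema over the half-line therefore replaces Gronwall's inequality: it bounds
  \<open>v(r,\<eta>') - v(r,\<eta>)\<close> and \<open>Z\<^sub>\<eta>(r)\<close>, it shows with dominated convergence that the derivative of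
  \<open>G(t,\<cdot>)\<close> is the limit of \<open>Z\<^sub>\<eta>(s)\<close> at \<open>-\<infinity>\<close>, and, run from \<open>-\<infinity>\<close>, it makes both \<open>G(t,\<cdot>)\<close> and this
  limit injective. The determinant of the limit is positive because \<open>det Z\<^sub>\<eta>\<close> never vanishes and
  equals one at \<open>t\<close>. Surjectivity is Brouwer's theorem, as \<open>G(t,\<cdot>)\<close> is a bounded perturbation of the
  identity. By (D3) the limit of \<open>Z\<^sub>\<eta>\<close> has continuous partial derivatives, whence \<open>C\<^sup>2\<close>.\<close>

section \<open>Norms on \<open>\<real>\<^sup>n\<close>\<close>

text \<open>The argument lives on the bound 1 in (D1), measured in the given norm \<open>N\<close>.
  An equivalence constant between \<open>N\<close> and the Euclidean norm may therefore be lost only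
  where mere integrability or convergence is at stake; the integral and mean value inequalities are
  proved for \<open>N\<close> itself, by testing with linear functionals. Three obstacles shape the
  rest. The supremum in (D1) runs over solutions \<open>y r 0 \<xi>\<close> issued at time 0;
  uniqueness makes \<open>y r 0\<close> surjective, so it is a supremum over all points of the
  space, and the mean value inequality turns it into a Lipschitz bound. The coefficient of the
  variational equation is only measurable in time, so \<open>Z\<close> is known through its integral
  equation, and measurability of the derivative comes from difference quotients. Finally, the flow
  is not differentiated at finite times: the error
  \<open>v r \<eta>' - v r \<eta> - Z \<eta> r *v (\<eta>' - \<eta>)\<close> vanishes at
  \<open>t\<close> and solves the linearized equation with a Taylor remainder as defect, which
  bounds it uniformly down to -infinity.\<close>

locale norm_on_Rn =
  fixes N :: "real^'n \<Rightarrow> real"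
  assumes vector_norm_N: "vector_norm N"
begin

lemma N_nonneg [simp]: "0 \<le> N x"
  and N_eq_0_iff [simp]: "N x = 0 \<longleftrightarrow> x = 0"
  and N_scaleR: "N (c *\<^sub>R x) = \<bar>c\<bar> * N x"
  and N_triangle: "N (x + y) \<le> N x + N y"
  using vector_norm_N by (auto simp: vector_norm_def)

lemma N_zero [simp]: "N 0 = 0"
  by simp

lemma N_pos: "x \<noteq> 0 \<Longrightarrow> 0 < N x"
  by (metis N_eq_0_iff N_nonneg less_eq_real_def)

lemma N_minus [simp]: "N (- x) = N x"
  using N_scaleR[of "-1" x] by simp

lemma N_triangle_diff: "N (x - y) \<le> N x + N y"
  using N_triangle[of x "- y"] by simp

lemma N_diff_commute: "N (x - y) = N (y - x)"
  using N_minus[of "x - y"] by simp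

lemma N_abs_diff_le: "\<bar>N x - N y\<bar> \<le> N (x - y)"
  using N_triangle[of "x - y" y] N_triangle[of "y - x" x] N_diff_commute[of x y]
  by simp

lemma N_sum_le: "N (sum u S) \<le> (\<Sum>i\<in>S. N (u i))"
proof (induction S rule: infinite_finite_induct)
  case (insert x F)
  then show ?case using N_triangle[of "u x" "sum u F"] by simp
qed auto

lemma N_le_norm: obtains C where "0 < C" "\<And>x. N x \<le> C * norm x"
proof -
  define C where "C = (\<Sum>b\<in>Basis. N b) + 1"
  have pos: "0 < C"
    unfolding C_def by (meson N_nonneg add_nonneg_pos sum_nonneg zero_less_one)
  have "N x \<le> C * norm x" for x
  proof -
    have "N x = N (\<Sum>b\<in>Basis. (x \<bullet> b) *\<^sub>R b)" by (simp add: euclidean_representation)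
    also have "\<dots> \<le> (\<Sum>b\<in>Basis. \<bar>x \<bullet> b\<bar> * N b)"
      using N_sum_le[of "\<lambda>b. (x \<bullet> b) *\<^sub>R b" Basis] by (simp add: N_scaleR)
    also have "\<dots> \<le> (\<Sum>b\<in>Basis. norm x * N b)"
      by (intro sum_mono mult_right_mono Basis_le_norm) auto
    also have "\<dots> \<le> C * norm x"
      by (simp add: C_def sum_distrib_left algebra_simps)
    finally show ?thesis .
  qed
  with pos show ?thesis using that by blast
qed

lemma continuous_on_N: "continuous_on S N"
proof -
  obtain C where C: "0 < C" "\<And>x. N x \<le> C * norm x" using N_le_norm by blast
  have "C-lipschitz_on S N"
    using C N_abs_diff_le by (auto simp: lipschitz_on_def dist_norm intro: order_trans)
  then show ?thesis by (rule lipschitz_on_continuous_on)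
qed

lemma tendsto_N [tendsto_intros]: "(u \<longlongrightarrow> l) F \<Longrightarrow> ((\<lambda>x. N (u x)) \<longlongrightarrow> N l) F"
  using continuous_on_N[of UNIV] continuous_on_tendsto_compose by fastforce

lemma continuous_on_N' [continuous_intros]:
  "continuous_on S u \<Longrightarrow> continuous_on S (\<lambda>x. N (u x))"
  by (rule continuous_on_compose2[OF continuous_on_N[of UNIV]]) auto

lemma borel_measurable_N [measurable]: "N \<in> borel_measurable borel"
  by (intro borel_measurable_continuous_onI continuous_on_N)

lemma norm_le_N: obtains C where "0 < C" "\<And>x. norm x \<le> C * N x"
proof -
  let ?S = "sphere (0 :: real^'n) 1"
  have ne: "?S \<noteq> {}" by simp
  obtain z where z: "z \<in> ?S" "\<And>x. x \<in> ?S \<Longrightarrow> N z \<le> N x"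
    using continuous_attains_inf[OF compact_sphere ne continuous_on_N] by blast
  have pos: "0 < N z" using z(1) by (metis N_eq_0_iff N_nonneg less_eq_real_def norm_zero
        mem_sphere_0 zero_neq_one)
  have "norm x \<le> inverse (N z) * N x" for x
  proof (cases "x = 0")
    case False
    then have "N z \<le> N (x /\<^sub>R norm x)" by (intro z) simp
    then show ?thesis using False pos by (simp add: N_scaleR field_simps)
  qed simp
  with pos show ?thesis using that[of "inverse (N z)"] by simp
qed

text \<open>A norm is the supremum of the linear functionals it dominates; this transfers one-dimensional
  estimates to an arbitrary norm without losing a constant factor.\<close>

lemma N_leI_dual:
  assumes "\<And>a. (\<And>v. a \<bullet> v \<le> N v) \<Longrightarrow> a \<bullet> w \<le> c"
  shows "N w \<le> c"
proof (rule ccontr)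
  assume "\<not> N w \<le> c"
  \<comment> \<open>The \<open>N\<close>-ball of radius \<open>B\<close>, with \<open>B\<close>
    strictly between \<open>c\<close> and \<open>N w\<close>, is closed and convex and misses
    \<open>w\<close>. The separating functional, rescaled until \<open>N\<close> dominates it, takes
    a value above \<open>c\<close> at \<open>w\<close>.\<close>
  then obtain B where B: "c < B" "B < N w" by (meson dense not_le)
  have "0 \<le> c" using assms[of 0] by simp
  with B have "0 < B" by simp
  let ?S = "{v. N v \<le> B}"
  have "convex ?S"
  proof (rule convexI, clarsimp)
    fix x y and u v :: real
    assume *: "N x \<le> B" "N y \<le> B" "0 \<le> u" "0 \<le> v" "u + v = 1"
    have "N (u *\<^sub>R x + v *\<^sub>R y) \<le> u * N x + v * N y"
      using N_triangle[of "u *\<^sub>R x" "v *\<^sub>R y"] * by (simp add: N_scaleR)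
    also have "\<dots> \<le> u * B + v * B" using * by (intro add_mono mult_left_mono) auto
    finally show "N (u *\<^sub>R x + v *\<^sub>R y) \<le> B" using * by (simp flip: distrib_right)
  qed
  moreover have "closed ?S"
    by (intro closed_Collect_le continuous_intros)
  moreover have "w \<notin> ?S" using B by simp
  ultimately obtain a' b' where ab': "a' \<bullet> w < b'" "\<And>x. N x \<le> B \<Longrightarrow> b' < a' \<bullet> x"
    using separating_hyperplane_closed_point[of ?S w] by auto
  define a b where "a = - a'" and "b = - b'"
  have ab: "b < a \<bullet> w" "\<And>x. N x \<le> B \<Longrightarrow> a \<bullet> x < b"
    using ab' by (auto simp: a_def b_def)
  have "0 < b" using ab(2)[of 0] \<open>0 < B\<close> by simp
  \<comment> \<open>The factor comes from testing \<open>a\<close> on the multiple of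
    \<open>v\<close> whose \<open>N\<close>-norm is exactly \<open>B\<close>.\<close>
  have "((B / b) *\<^sub>R a) \<bullet> v \<le> N v" for v
  proof (cases "v = 0")
    case False
    then have Nv: "0 < N v" by (metis N_eq_0_iff N_nonneg less_eq_real_def)
    have "a \<bullet> ((B / N v) *\<^sub>R v) < b"
      using Nv \<open>0 < B\<close> by (intro ab(2)) (simp add: N_scaleR)
    then show ?thesis using Nv \<open>0 < b\<close> \<open>0 < B\<close> by (simp add: field_simps)
  qed simp
  then have "((B / b) *\<^sub>R a) \<bullet> w \<le> c" by (rule assms)
  moreover have "B \<le> (B / b) * (a \<bullet> w)"
    using ab(1) \<open>0 < b\<close> \<open>0 < B\<close> by (simp add: field_simps)
  ultimately show False using B by simp
qed

lemma set_integrable_N: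
  assumes "set_integrable lborel S u"
  shows "set_integrable lborel S (\<lambda>r. N (u r))"
proof -
  obtain C where C: "0 < C" "\<And>x. N x \<le> C * norm x" using N_le_norm by blast
  have "(\<lambda>x. indicator S x *\<^sub>R N (u x)) = (\<lambda>x. N (indicator S x *\<^sub>R u x))"
    by (auto simp: N_scaleR)
  moreover have "integrable lborel (\<lambda>x. N (indicator S x *\<^sub>R u x))"
  proof (rule Bochner_Integration.integrable_bound)
    show "integrable lborel (\<lambda>x. C * norm (indicator S x *\<^sub>R u x))"
      using assms by (intro integrable_mult_right integrable_norm) (simp add: set_integrable_def)
    show "(\<lambda>x. N (indicator S x *\<^sub>R u x)) \<in> borel_measurable lborel"
      using borel_measurable_integrable[OF assms[unfolded set_integrable_def]]
      by (rule measurable_compose) simp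
    show "AE x in lborel. norm (N (indicator S x *\<^sub>R u x))
        \<le> norm (C * norm (indicator S x *\<^sub>R u x))"
      using C by (intro AE_I2) (simp del: norm_scaleR)
  qed
  ultimately show ?thesis by (simp add: set_integrable_def)
qed

text \<open>A functional dominated by \<open>N\<close> passes under the integral, and
  \<open>N_leI_dual\<close> recovers \<open>N\<close> from all of them. Constant 1 here is what
  preserves the strict contraction.\<close>

lemma N_set_integral_le:
  assumes "set_integrable lborel S u"
  shows "N (LINT r:S|lborel. u r) \<le> (LINT r:S|lborel. N (u r))"
proof (rule N_leI_dual)
  fix a assume a: "\<And>v. a \<bullet> v \<le> N v"
  have "a \<bullet> (LINT r:S|lborel. u r) = (LINT r:S|lborel. a \<bullet> u r)"
    using integral_inner_right[of a lborel "\<lambda>r. indicator S r *\<^sub>R u r"] assms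
    by (simp add: set_integrable_def set_lebesgue_integral_def)
  also have "\<dots> \<le> (LINT r:S|lborel. N (u r))"
  proof (rule set_integral_mono)
    show "set_integrable lborel S (\<lambda>r. a \<bullet> u r)"
      using integrable_inner_right[of a lborel "\<lambda>r. indicator S r *\<^sub>R u r"] assms
      by (simp add: set_integrable_def)
  qed (use a set_integrable_N[OF assms] in auto)
  finally show "a \<bullet> (LINT r:S|lborel. u r) \<le> (LINT r:S|lborel. N (u r))" .
qed

text \<open>Only integrability is concluded, so the equivalence constant of the two norms is
  harmless.\<close>

lemma set_integrable_boundN:
  assumes "u \<in> borel_measurable borel" "set_integrable lborel S \<beta>" "S \<in> sets borel"
    and "\<And>r. r \<in> S \<Longrightarrow> N (u r) \<le> \<beta> r"
  shows "set_integrable lborel S u"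
proof -
  obtain C where C: "0 < C" "\<And>x. norm x \<le> C * N x" using norm_le_N by blast
  show ?thesis
  proof (rule set_integrable_bound)
    show "set_integrable lborel S (\<lambda>r. C * \<beta> r)"
      using assms(2) by simp
    show "set_borel_measurable lborel S u"
      using assms(1,3) unfolding set_borel_measurable_def by measurable
    show "AE x in lborel. x \<in> S \<longrightarrow> norm (u x) \<le> norm (C * \<beta> x)"
    proof (intro AE_I2 impI)
      fix x assume "x \<in> S"
      then have "C * N (u x) \<le> C * \<beta> x" using assms(4) C by simp
      then show "norm (u x) \<le> norm (C * \<beta> x)" using C(2)[of "u x"] by simp
    qed
  qed
qed

text \<open>The scalar mean value theorem for \<open>a \<bullet> g\<close> on the segment from
  \<open>y\<close> to \<open>x\<close>, for each functional \<open>a\<close> dominated by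
  \<open>N\<close>; thus \<open>c\<close> survives unchanged.\<close>

lemma N_mvt:
  assumes "\<And>x. (g has_derivative g' x) (at x)" "\<And>x h. N (g' x h) \<le> c * N h"
  shows "N (g x - g y) \<le> c * N (x - y)"
proof (rule N_leI_dual)
  fix a assume a: "\<And>v. a \<bullet> v \<le> N v"
  let ?k = "\<lambda>\<tau>. a \<bullet> g (y + \<tau> *\<^sub>R (x - y))"
  have "\<exists>\<tau>\<in>{0<..<1}. ?k 1 - ?k 0 = (\<lambda>h. a \<bullet> g' (y + \<tau> *\<^sub>R (x - y)) (h *\<^sub>R (x - y))) (1 - 0)"
  proof (rule mvt_simple)
    fix \<tau> :: real
    show "(?k has_derivative (\<lambda>h. a \<bullet> g' (y + \<tau> *\<^sub>R (x - y)) (h *\<^sub>R (x - y)))) (at \<tau> within {0..1})"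
      by (rule has_derivative_at_withinI, (rule derivative_eq_intros assms(1)[THEN has_derivative_compose[rotated]] refl)+) simp
  qed simp
  then obtain \<tau> where "a \<bullet> g x - a \<bullet> g y = a \<bullet> g' (y + \<tau> *\<^sub>R (x - y)) (x - y)"
    by auto
  then show "a \<bullet> (g x - g y) \<le> c * N (x - y)"
    using a[of "g' (y + \<tau> *\<^sub>R (x - y)) (x - y)"] assms(2)[of "y + \<tau> *\<^sub>R (x - y)" "x - y"]
    by (simp add: inner_diff_right)
qed

text \<open>The content is boundedness of the quotients: the real-valued \<open>SUP\<close> in
  \<open>op_norm\<close> is an upper bound only then. It follows from equivalence with the Euclidean
  norm.\<close>

lemma N_matrix_vector_le: "N (B *v x) \<le> op_norm N B * N x"
proof -
  obtain C where C: "0 < C" "\<And>x. N x \<le> C * norm x" using N_le_norm by blast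
  obtain c where c: "0 < c" "\<And>x. norm x \<le> c * N x" using norm_le_N by blast
  have "bdd_above (range (\<lambda>x. N (B *v x) / N x))"
  proof (rule bdd_aboveI2)
    fix x
    have "N (B *v x) \<le> C * (onorm ((*v) B) * norm x)"
      using C onorm[OF matrix_vector_mul_bounded_linear[of B], of x]
      by (meson mult_left_mono less_imp_le order_trans)
    also have "\<dots> \<le> C * (onorm ((*v) B) * (c * N x))"
      using C c by (intro mult_left_mono) (auto simp: onorm_pos_le)
    finally show "N (B *v x) / N x \<le> C * onorm ((*v) B) * c"
      using C c by (cases "x = 0") (auto simp: field_simps onorm_pos_le
          matrix_vector_mul_bounded_linear dest: N_pos)
  qed
  then have "N (B *v x) / N x \<le> op_norm N B"
    unfolding op_norm_def by (rule cSUP_upper2) auto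
  then show ?thesis
    by (cases "x = 0") (auto simp: field_simps dest: N_pos)
qed

end

section \<open>Maps of class \<open>C\<^sup>1\<close> and \<open>C\<^sup>2\<close>\<close>

lemma has_vector_derivative_at_shift:
  assumes "((\<lambda>h. k (a + h)) has_vector_derivative D) (at (0::real))"
  shows "(k has_vector_derivative D) (at a)"
proof -
  have "((\<lambda>h. k (a + h)) \<circ> (\<lambda>\<tau>. \<tau> - a) has_vector_derivative 1 *\<^sub>R D) (at a)"
    using assms by (intro vector_diff_chain_at) (auto intro!: derivative_eq_intros)
  then show ?thesis by (simp add: o_def)
qed

lemma has_derivative_partials:
  fixes g :: "'a::euclidean_space \<Rightarrow> 'b::real_normed_vector"
  assumes D: "\<And>b x. b \<in> Basis \<Longrightarrow> ((\<lambda>\<tau>. g (x + \<tau> *\<^sub>R b)) has_vector_derivative D b x) (at 0)"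
    and cont: "\<And>b. b \<in> Basis \<Longrightarrow> continuous_on UNIV (D b)"
  shows "(g has_derivative (\<lambda>h. \<Sum>b\<in>Basis. (h \<bullet> b) *\<^sub>R D b x)) (at x)"
proof -
  have D': "((\<lambda>\<tau>. g (p + \<tau> *\<^sub>R b)) has_vector_derivative D b (p + \<tau>0 *\<^sub>R b)) (at \<tau>0)"
    if "b \<in> Basis" for b p \<tau>0
    using D[OF that, of "p + \<tau>0 *\<^sub>R b"]
    by (simp add: has_vector_derivative_at_shift[where k = "\<lambda>\<tau>. g (p + \<tau> *\<^sub>R b)"]
        scaleR_add_left add.assoc)
  show ?thesis
  proof (rule has_derivative_at_alt[THEN iffD2], intro conjI allI impI)
    show "bounded_linear (\<lambda>h. \<Sum>b\<in>Basis. (h \<bullet> b) *\<^sub>R D b x)"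
      by (intro bounded_linear_intros)
  next
    fix e :: real assume e: "0 < e"
    \<comment> \<open>Each basis direction receives an equal share of the error
      \<open>e\<close>.\<close>
    define \<epsilon> where "\<epsilon> = e / DIM('a)"
    have \<epsilon>: "0 < \<epsilon>" using e by (simp add: \<epsilon>_def)
    have "\<forall>\<^sub>F z in nhds x. \<forall>b\<in>Basis. dist (D b z) (D b x) < \<epsilon>"
      using cont \<epsilon> by (intro eventually_ball_finite ballI finite_Basis tendstoD)
        (auto simp: continuous_on_def tendsto_at_iff_tendsto_nhds)
    then obtain \<delta> where \<delta>: "0 < \<delta>" "\<And>z b. dist z x < \<delta> \<Longrightarrow> b \<in> Basis \<Longrightarrow> norm (D b z - D b x) < \<epsilon>"
      by (auto simp: eventually_nhds_metric dist_norm)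
    \<comment> \<open>Telescoping over coordinates: inserting \<open>k\<close> moves the point along
      one axis, and the mean value inequality is applied to \<open>g\<close> minus its linear part
      at \<open>x\<close>, whose derivative on that segment is at most
      \<open>\<epsilon>\<close>.\<close>
    have step: "norm (g (x + (\<Sum>b\<in>S. (h \<bullet> b) *\<^sub>R b)) - g x - (\<Sum>b\<in>S. (h \<bullet> b) *\<^sub>R D b x))
        \<le> \<epsilon> * (\<Sum>b\<in>S. norm h)" if "finite S" "S \<subseteq> Basis" "norm h < \<delta>" for S h
      using that
    proof (induction S rule: finite_induct)
      case (insert k S)
      then have k: "k \<in> Basis" and S: "S \<subseteq> Basis" by auto
      let ?p = "x + (\<Sum>b\<in>S. (h \<bullet> b) *\<^sub>R b)"
      \<comment> \<open>Relative to \<open>x\<close>, each coordinate of an intermediate point is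
        bounded by that of \<open>h\<close>, so the point stays in the
        \<open>\<delta>\<close>-ball.\<close>
      have near: "dist (?p + \<tau> *\<^sub>R k) x < \<delta>" if \<tau>: "\<tau> \<in> closed_segment 0 (h \<bullet> k)" for \<tau>
      proof -
        have abs: "\<bar>\<tau>\<bar> \<le> \<bar>h \<bullet> k\<bar>" using \<tau> by (auto simp: closed_segment_eq_real_ivl split: if_splits)
        have "norm ((\<Sum>b\<in>S. (h \<bullet> b) *\<^sub>R b) + \<tau> *\<^sub>R k) \<le> norm h"
        proof (rule norm_le_componentwise)
          fix b :: 'a assume b: "b \<in> Basis"
          have "(\<Sum>c\<in>S. (h \<bullet> c) *\<^sub>R c) \<bullet> b = (\<Sum>c\<in>S. if c = b then h \<bullet> c else 0)"
            unfolding inner_sum_left using S b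
            by (intro sum.cong refl) (auto simp: inner_Basis)
          also have "\<dots> = (if b \<in> S then h \<bullet> b else 0)"
            using insert.hyps(1) by (simp add: sum.delta')
          finally show "\<bar>((\<Sum>b\<in>S. (h \<bullet> b) *\<^sub>R b) + \<tau> *\<^sub>R k) \<bullet> b\<bar> \<le> \<bar>h \<bullet> b\<bar>"
            using abs k b insert.hyps(2) by (auto simp: inner_add_left inner_Basis)
        qed
        then show ?thesis using insert.prems by (simp add: dist_norm add.assoc)
      qed
      have "norm ((g (?p + (h \<bullet> k) *\<^sub>R k) - (h \<bullet> k) *\<^sub>R D k x) - (g (?p + 0 *\<^sub>R k) - 0 *\<^sub>R D k x))
          \<le> \<epsilon> * norm (h \<bullet> k - 0)"
      proof (rule differentiable_bound[where S = "closed_segment 0 (h \<bullet> k)"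
            and f' = "\<lambda>\<tau> d. d *\<^sub>R (D k (?p + \<tau> *\<^sub>R k) - D k x)"])
        fix \<tau> assume \<tau>: "\<tau> \<in> closed_segment 0 (h \<bullet> k)"
        have "((\<lambda>\<tau>. g (?p + \<tau> *\<^sub>R k) - \<tau> *\<^sub>R D k x) has_vector_derivative
            (D k (?p + \<tau> *\<^sub>R k) - D k x)) (at \<tau> within closed_segment 0 (h \<bullet> k))"
          by (rule has_vector_derivative_at_within, rule has_vector_derivative_diff[OF D'[OF k]])
             (auto intro!: derivative_eq_intros)
        then show "((\<lambda>\<tau>. g (?p + \<tau> *\<^sub>R k) - \<tau> *\<^sub>R D k x) has_derivative
            (\<lambda>d. d *\<^sub>R (D k (?p + \<tau> *\<^sub>R k) - D k x))) (at \<tau> within closed_segment 0 (h \<bullet> k))"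
          by (simp add: has_vector_derivative_def)
        show "onorm (\<lambda>d. d *\<^sub>R (D k (?p + \<tau> *\<^sub>R k) - D k x)) \<le> \<epsilon>"
        proof (rule onorm_bound)
          show "norm (d *\<^sub>R (D k (?p + \<tau> *\<^sub>R k) - D k x)) \<le> \<epsilon> * norm d" for d :: real
            unfolding norm_scaleR mult.commute[of \<epsilon>] real_norm_def
            by (rule mult_left_mono[OF less_imp_le[OF \<delta>(2)[OF near[OF \<tau>] k]] abs_ge_zero])
        qed (use \<epsilon> in simp)
      qed auto
      also have "\<dots> \<le> \<epsilon> * norm h"
        using k \<epsilon> by (simp add: Basis_le_norm)
      finally have 1: "norm (g (?p + (h \<bullet> k) *\<^sub>R k) - g ?p - (h \<bullet> k) *\<^sub>R D k x) \<le> \<epsilon> * norm h"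
        by (simp add: algebra_simps)
      have 2: "norm (g ?p - g x - (\<Sum>b\<in>S. (h \<bullet> b) *\<^sub>R D b x)) \<le> \<epsilon> * (\<Sum>b\<in>S. norm h)"
        using insert S by blast
      have eq: "g (x + (\<Sum>b\<in>insert k S. (h \<bullet> b) *\<^sub>R b)) - g x - (\<Sum>b\<in>insert k S. (h \<bullet> b) *\<^sub>R D b x)
          = (g (?p + (h \<bullet> k) *\<^sub>R k) - g ?p - (h \<bullet> k) *\<^sub>R D k x)
            + (g ?p - g x - (\<Sum>b\<in>S. (h \<bullet> b) *\<^sub>R D b x))"
        using insert.hyps by (simp add: algebra_simps)
      have 3: "\<epsilon> * (\<Sum>b\<in>insert k S. norm h) = \<epsilon> * norm h + \<epsilon> * (\<Sum>b\<in>S. norm h)"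
        by (subst sum.insert[OF insert.hyps]) (rule distrib_left)
      show ?case unfolding eq 3 by (rule norm_triangle_le[OF add_mono[OF 1 2]])
    qed simp
    have "norm (g y - g x - (\<Sum>b\<in>Basis. ((y - x) \<bullet> b) *\<^sub>R D b x)) \<le> e * norm (y - x)"
      if "norm (y - x) < \<delta>" for y
    proof -
      have "x + (\<Sum>b\<in>Basis. ((y - x) \<bullet> b) *\<^sub>R b) = y"
        by (simp add: euclidean_representation)
      then show ?thesis
        using step[OF finite_Basis order_refl that] by (simp add: \<epsilon>_def)
    qed
    then show "\<exists>d>0. \<forall>y. norm (y - x) < d \<longrightarrow>
        norm (g y - g x - (\<Sum>b\<in>Basis. ((y - x) \<bullet> b) *\<^sub>R D b x)) \<le> e * norm (y - x)"
      using \<delta>(1) by blast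
  qed
qed

text \<open>By \<open>C2I\<close> a map is \<open>C2\<close> once its derivative is
  \<open>C1\<close>. Second derivatives are thereby handled by first-order rules for operator-valued
  maps.\<close>

definition C1 :: "('a::real_normed_vector \<Rightarrow> 'b::real_normed_vector) \<Rightarrow> bool" where
  "C1 g \<longleftrightarrow> (\<exists>g' :: 'a \<Rightarrow> 'a \<Rightarrow>\<^sub>L 'b.
     (\<forall>x. (g has_derivative blinfun_apply (g' x)) (at x)) \<and> continuous_on UNIV g')"

lemma C1I:
  "(\<And>x. (g has_derivative blinfun_apply (g' x)) (at x)) \<Longrightarrow> continuous_on UNIV g' \<Longrightarrow> C1 g"
  unfolding C1_def by blast

lemma C2I: "(\<And>x. (g has_derivative blinfun_apply (g' x)) (at x)) \<Longrightarrow> C1 g' \<Longrightarrow> C2 g"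
  unfolding C2_def C1_def by blast

lemma C1_continuous: "C1 g \<Longrightarrow> continuous_on UNIV g"
  unfolding C1_def by (meson continuous_at_imp_continuous_on has_derivative_continuous)

lemma C1_compose:
  assumes "C1 g" "C1 h"
  shows "C1 (\<lambda>x. g (h x))"
proof -
  obtain g' where g: "\<And>x. (g has_derivative blinfun_apply (g' x)) (at x)" "continuous_on UNIV g'"
    using assms(1) by (auto simp: C1_def)
  obtain h' where h: "\<And>x. (h has_derivative blinfun_apply (h' x)) (at x)" "continuous_on UNIV h'"
    using assms(2) by (auto simp: C1_def)
  show ?thesis
  proof (rule C1I)
    show "((\<lambda>x. g (h x)) has_derivative blinfun_apply (g' (h x) o\<^sub>L h' x)) (at x)" for x
      using has_derivative_compose[OF h(1) g(1)] by (simp add: blinfun_compose.rep_eq o_def)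
    show "continuous_on UNIV (\<lambda>x. g' (h x) o\<^sub>L h' x)"
      using continuous_on_compose2[OF g(2) C1_continuous[OF assms(2)]] h(2)
      by (intro continuous_intros) auto
  qed
qed

lemma C1_bounded_linear: "bounded_linear L \<Longrightarrow> C1 L"
  by (rule C1I[where g' = "\<lambda>_. Blinfun L"])
    (auto simp: bounded_linear_Blinfun_apply bounded_linear_imp_has_derivative)

lemma C1_sum:
  assumes "\<And>i. i \<in> S \<Longrightarrow> C1 (u i)"
  shows "C1 (\<lambda>x. \<Sum>i\<in>S. u i x)"
proof -
  obtain u' where u': "\<And>i x. i \<in> S \<Longrightarrow> (u i has_derivative blinfun_apply (u' i x)) (at x)"
      "\<And>i. i \<in> S \<Longrightarrow> continuous_on UNIV (u' i)"
    using assms unfolding C1_def by metis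
  show ?thesis
  proof (rule C1I)
    show "((\<lambda>x. \<Sum>i\<in>S. u i x) has_derivative blinfun_apply (\<Sum>i\<in>S. u' i x)) (at x)" for x
      by (rule has_derivative_eq_rhs[OF has_derivative_sum[OF u'(1)]]) (auto simp: blinfun.sum_left)
    show "continuous_on UNIV (\<lambda>x. \<Sum>i\<in>S. u' i x)"
      using u' by (intro continuous_intros)
  qed
qed

text \<open>The tensor of \<open>w\<close> with the functional \<open>b\<close>, built from bundled
  maps so that it is visibly linear in \<open>w\<close>. Smoothness of vectors thus carries over to
  the operators assembled from them.\<close>

definition rank_one :: "'a::real_inner \<Rightarrow> 'b::real_normed_vector \<Rightarrow> 'a \<Rightarrow>\<^sub>L 'b" where
  "rank_one b w = blinfun_scaleR_left w o\<^sub>L blinfun_inner_left b"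

lemma rank_one_apply [simp]: "rank_one b w h = (h \<bullet> b) *\<^sub>R w"
  by (simp add: rank_one_def)

lemma bounded_linear_rank_one: "bounded_linear (rank_one b)"
  unfolding rank_one_def by (intro bounded_linear_intros)

lemma C1_partials:
  fixes g :: "'a::euclidean_space \<Rightarrow> 'b::real_normed_vector"
  assumes "\<And>b x. b \<in> Basis \<Longrightarrow> ((\<lambda>\<tau>. g (x + \<tau> *\<^sub>R b)) has_vector_derivative D b x) (at 0)"
    and "\<And>b. b \<in> Basis \<Longrightarrow> continuous_on UNIV (D b)"
  shows "C1 g"
proof (rule C1I)
  show "(g has_derivative blinfun_apply (\<Sum>b\<in>Basis. rank_one b (D b x))) (at x)" for x
    by (rule has_derivative_eq_rhs[OF has_derivative_partials[of g D x, OF assms]])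
      (auto simp: blinfun.sum_left)
  show "continuous_on UNIV (\<lambda>x. \<Sum>b\<in>Basis. rank_one b (D b x))"
    using assms(2)
    by (intro continuous_intros bounded_linear.continuous_on[OF bounded_linear_rank_one])
qed

text \<open>Stated for a general product so that it applies to matrices and to \<^typ>\<open>'a \<Rightarrow>\<^sub>L 'a\<close>.\<close>

lemma inverse_family:
  fixes mul :: "'b \<Rightarrow> 'b \<Rightarrow> 'b::real_normed_vector" and A B :: "'a::real_normed_vector \<Rightarrow> 'b"
  assumes bil: "bounded_bilinear mul"
    and assoc: "\<And>u v w. mul (mul u v) w = mul u (mul v w)"
    and unit: "\<And>u. mul e u = u" "\<And>u. mul u e = u"
    and inv: "\<And>x. mul (B x) (A x) = e" "\<And>x. mul (A x) (B x) = e"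
  shows isCont_inverse_family: "isCont A x \<Longrightarrow> isCont B x"
    and has_derivative_inverse_family: "(A has_derivative A') (at x) \<Longrightarrow>
      (B has_derivative (\<lambda>h. - mul (mul (B x) (A' h)) (B x))) (at x)"
proof -
  interpret bounded_bilinear mul by (rule bil)
  obtain C where C: "0 < C" "\<And>u v. norm (mul u v) \<le> norm u * norm v * C"
    using pos_bounded by blast
  \<comment> \<open>The resolvent identity, from which both continuity and the derivative formula
    are read off.\<close>
  have diff: "B y - B x = - mul (mul (B y) (A y - A x)) (B x)" for y
  proof -
    have "mul (mul (B y) (A y - A x)) (B x)
        = mul (mul (B y) (A y)) (B x) - mul (B y) (mul (A x) (B x))"
      by (simp add: diff_left diff_right assoc)
    then show ?thesis by (simp add: inv unit)
  qed
  have diff_le: "norm (B y - B x) \<le> norm (B y) * (norm (A y - A x) * norm (B x) * C\<^sup>2)" for y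
  proof -
    have "norm (B y - B x) \<le> norm (mul (B y) (A y - A x)) * norm (B x) * C"
      unfolding diff norm_minus_cancel by (rule C)
    also have "\<dots> \<le> (norm (B y) * norm (A y - A x) * C) * norm (B x) * C"
      using C by (intro mult_right_mono) auto
    finally show ?thesis by (simp add: power2_eq_square algebra_simps)
  qed
  show cont: "isCont B x" if A: "isCont A x"
  proof -
    \<comment> \<open>No bound on \<open>B\<close> near \<open>x\<close> is known beforehand. Once
      \<open>\<epsilon> y < 1 / 2\<close>, the term \<open>norm (B y) * \<epsilon> y\<close> can be
      absorbed, giving \<open>norm (B y) \<le> 2 * norm (B x)\<close>.\<close>
    define \<epsilon> where "\<epsilon> y = norm (A y - A x) * norm (B x) * C\<^sup>2" for y
    have "(\<epsilon> \<longlongrightarrow> norm (A x - A x) * norm (B x) * C\<^sup>2) (at x)"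
      unfolding \<epsilon>_def using A unfolding isCont_def by (intro tendsto_intros)
    then have \<epsilon>: "(\<epsilon> \<longlongrightarrow> 0) (at x)" by simp
    have "\<forall>\<^sub>F y in at x. \<epsilon> y < 1 / 2"
      using \<epsilon> by (rule order_tendstoD) simp
    then have "\<forall>\<^sub>F y in at x. norm (B y - B x) \<le> (2 * norm (B x)) * \<epsilon> y"
    proof eventually_elim
      case (elim y)
      have le: "norm (B y - B x) \<le> norm (B y) * \<epsilon> y"
        using diff_le by (simp add: \<epsilon>_def)
      also have "\<dots> \<le> norm (B y) * (1 / 2)"
        using elim by (intro mult_left_mono) auto
      finally have "norm (B y) \<le> 2 * norm (B x)"
        using norm_triangle_sub[of "B y" "B x"] by simp
      moreover have "0 \<le> \<epsilon> y" using C by (simp add: \<epsilon>_def)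
      ultimately show ?case using le by (meson mult_right_mono order_trans)
    qed
    moreover have "((\<lambda>y. (2 * norm (B x)) * \<epsilon> y) \<longlongrightarrow> 0) (at x)"
      using \<epsilon> by (rule tendsto_mult_right_zero)
    ultimately have "((\<lambda>y. B y - B x) \<longlongrightarrow> 0) (at x)"
      by (rule Lim_null_comparison)
    then show "isCont B x" by (simp add: isCont_def LIM_zero_iff)
  qed
  assume A: "(A has_derivative A') (at x)"
  then interpret A': bounded_linear A' by (rule has_derivative_bounded_linear)
  obtain L where L: "\<And>h. norm (A' h) \<le> norm h * L"
    using A'.pos_bounded by blast
  have Bx: "((\<lambda>y. B y - B x) \<longlongrightarrow> 0) (at x)"
    using cont[OF has_derivative_continuous[OF A]] by (simp add: isCont_def LIM_zero_iff)
  define q where "q y = (1 / norm (y - x)) *\<^sub>R (A y - (A x + A' (y - x)))" for y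
  have q: "(q \<longlongrightarrow> 0) (at x)"
    using A unfolding has_derivative_within q_def by simp
  let ?D = "\<lambda>h. - mul (mul (B x) (A' h)) (B x)"
  let ?s = "\<lambda>y. A' ((1 / norm (y - x)) *\<^sub>R (y - x))"
  \<comment> \<open>The normalized direction has no limit, but its image under \<open>A'\<close>
    stays bounded, and the other factor tends to 0.\<close>
  have s: "((\<lambda>y. mul (B y - B x) (?s y)) \<longlongrightarrow> 0) (at x)"
  proof (rule Lim_null_comparison)
    show "\<forall>\<^sub>F y in at x. norm (mul (B y - B x) (?s y)) \<le> norm (B y - B x) * (\<bar>L\<bar> * C)"
    proof (rule always_eventually, rule allI)
      fix y
      have "norm (?s y) \<le> norm ((1 / norm (y - x)) *\<^sub>R (y - x)) * L" by (rule L)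
      also have "\<dots> \<le> \<bar>L\<bar>" by auto
      finally have "norm (B y - B x) * norm (?s y) * C \<le> norm (B y - B x) * \<bar>L\<bar> * C"
        using C by (intro mult_left_mono mult_right_mono) auto
      then show "norm (mul (B y - B x) (?s y)) \<le> norm (B y - B x) * (\<bar>L\<bar> * C)"
        using C(2)[of "B y - B x" "?s y"] by (simp add: mult.assoc)
    qed
    show "((\<lambda>y. norm (B y - B x) * (\<bar>L\<bar> * C)) \<longlongrightarrow> 0) (at x)"
      using tendsto_norm_zero[OF Bx] by (rule tendsto_mult_left_zero)
  qed
  have "((\<lambda>y. - mul (mul (B y - B x) (q y) + mul (B y - B x) (?s y) + mul (B x) (q y)) (B x))
      \<longlongrightarrow> - mul (mul 0 0 + 0 + mul (B x) 0) (B x)) (at x)"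
    by (intro tendsto_intros tendsto Bx q s)
  then have lim: "((\<lambda>y. - mul (mul (B y - B x) (q y) + mul (B y - B x) (?s y) + mul (B x) (q y)) (B x))
      \<longlongrightarrow> 0) (at x)"
    by (simp add: zero_left zero_right)
  have eq: "- mul (mul (B y - B x) (q y) + mul (B y - B x) (?s y) + mul (B x) (q y)) (B x)
      = (1 / norm (y - x)) *\<^sub>R (B y - (B x + ?D (y - x)))" for y
  proof -
    have "q y + ?s y = (1 / norm (y - x)) *\<^sub>R (A y - A x)"
      unfolding q_def A'.scaleR by (simp add: scaleR_diff_right scaleR_add_right)
    then have h1: "mul (B y - B x) (q y) + mul (B y - B x) (?s y)
        = (1 / norm (y - x)) *\<^sub>R mul (B y - B x) (A y - A x)"
      by (simp flip: add_right scaleR_right)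
    have h2: "mul (B x) (q y)
        = (1 / norm (y - x)) *\<^sub>R (mul (B x) (A y - A x) - mul (B x) (A' (y - x)))"
      by (simp add: q_def scaleR_right add_right diff_right algebra_simps)
    have "mul (B y - B x) (q y) + mul (B y - B x) (?s y) + mul (B x) (q y)
        = (1 / norm (y - x)) *\<^sub>R (mul (B y) (A y - A x) - mul (B x) (A' (y - x)))"
      unfolding h1 h2 unfolding scaleR_add_right[symmetric] diff_left by simp
    then have h3: "- mul (mul (B y - B x) (q y) + mul (B y - B x) (?s y) + mul (B x) (q y)) (B x)
        = (1 / norm (y - x)) *\<^sub>R (- mul (mul (B y) (A y - A x)) (B x) - ?D (y - x))"
      by (simp add: scaleR_left diff_left scaleR_diff_right)
    show ?thesis
      unfolding h3 unfolding diff[symmetric] diff_diff_eq ..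
  qed
  show "(B has_derivative ?D) (at x)"
    unfolding has_derivative_within
  proof
    show "bounded_linear ?D"
      by (intro bounded_linear_minus bounded_linear_compose[OF bounded_linear_left]
          bounded_linear_compose[OF bounded_linear_right] A'.bounded_linear_axioms)
    show "((\<lambda>y. (1 / norm (y - x)) *\<^sub>R (B y - (B x + ?D (y - x)))) \<longlongrightarrow> 0) (at x)"
      using lim unfolding eq .
  qed
qed

text \<open>The derivative is \<open>- B A' B\<close>. Continuity of \<open>B\<close> comes first
  and makes this formula continuous in turn.\<close>

lemma C1_inverse_family:
  fixes mul :: "'b \<Rightarrow> 'b \<Rightarrow> 'b::real_normed_vector" and A B :: "'a::real_normed_vector \<Rightarrow> 'b"
  assumes bil: "bounded_bilinear mul"
    and assoc: "\<And>u v w. mul (mul u v) w = mul u (mul v w)"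
    and unit: "\<And>u. mul e u = u" "\<And>u. mul u e = u"
    and inv: "\<And>x. mul (B x) (A x) = e" "\<And>x. mul (A x) (B x) = e"
    and A: "C1 A"
  shows "C1 B"
proof -
  interpret bounded_bilinear mul by (rule bil)
  obtain A' where A': "\<And>x. (A has_derivative blinfun_apply (A' x)) (at x)" "continuous_on UNIV A'"
    using A by (auto simp: C1_def)
  have "isCont B x" for x
    using has_derivative_continuous[OF A'(1)] by (rule isCont_inverse_family[OF bil assoc unit inv])
  then have B: "continuous_on UNIV B" by (simp add: continuous_at_imp_continuous_on)
  show ?thesis
  proof (rule C1I)
    show "(B has_derivative blinfun_apply (- (prod_left (B x) o\<^sub>L (prod_right (B x) o\<^sub>L A' x)))) (at x)" for x
      by (rule has_derivative_eq_rhs[OF has_derivative_inverse_family[OF bil assoc unit inv A'(1)]])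
        (simp add: fun_eq_iff blinfun.minus_left)
    show "continuous_on UNIV (\<lambda>x. - (prod_left (B x) o\<^sub>L (prod_right (B x) o\<^sub>L A' x)))"
      by (intro continuous_intros A'(2) bounded_linear.continuous_on[OF bounded_linear_prod_left]
          bounded_linear.continuous_on[OF bounded_linear_prod_right] B)
  qed
qed


section \<open>Contracting linear estimates on a half-line\<close>

locale contraction = norm_on_Rn N for N :: "real^'n \<Rightarrow> real" +
  fixes t :: real and \<phi> :: "real \<Rightarrow> real"
  assumes phi_nonneg: "\<And>r. 0 \<le> \<phi> r"
    and phi_int: "set_integrable lborel {..t} \<phi>"
    and phi_lt1: "(LINT r:{..t}|lborel. \<phi> r) < 1"
begin

definition q :: real where "q = (LINT r:{..t}|lborel. \<phi> r)"

lemma q: "0 \<le> q" "q < 1"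
  using phi_lt1 phi_nonneg unfolding q_def set_lebesgue_integral_def
  by (auto intro!: integral_nonneg)

text \<open>\<open>w\<close> solves \<open>w' = u\<close> on \<open>(-\<infinity>, t]\<close> in integrated form, and \<open>u\<close> is linear in \<open>w\<close> up to the defect \<open>\<rho>\<close>.
  Since \<open>\<integral>\<phi> < 1\<close>, the supremum of \<open>w\<close> can be absorbed, both from the value at \<open>t\<close> and from the
  limit at \<open>-\<infinity>\<close>.\<close>

definition backward :: "(real \<Rightarrow> real^'n) \<Rightarrow> (real \<Rightarrow> real^'n) \<Rightarrow> (real \<Rightarrow> real) \<Rightarrow> bool" where
  "backward w u \<rho> \<longleftrightarrow> u \<in> borel_measurable borel \<and> continuous_on {..t} w \<and>
     (\<forall>s\<le>t. w s = w t - (LINT r:{s..t}|lborel. u r)) \<and>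
     set_integrable lborel {..t} \<rho> \<and> (\<forall>r\<le>t. 0 \<le> \<rho> r \<and> N (u r) \<le> \<phi> r * N (w r) + \<rho> r)"

text \<open>Apply \<open>step\<close> with \<open>B\<close> the supremum itself:
  \<open>B \<le> c + q * B\<close>, and \<open>q < 1\<close>. The crude bound \<open>B0\<close>
  serves only to make the supremum finite and does not enter the result.\<close>

lemma sup_absorb:
  assumes "\<And>r. r \<in> S \<Longrightarrow> u r \<le> B0" "\<And>r. r \<in> S \<Longrightarrow> 0 \<le> u r" "r \<in> S"
    and step: "\<And>B r. (\<And>r. r \<in> S \<Longrightarrow> u r \<le> B) \<Longrightarrow> 0 \<le> B \<Longrightarrow> r \<in> S \<Longrightarrow> u r \<le> c + q * B"
  shows "u r \<le> c / (1 - q)"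
proof -
  define B where "B = (SUP r\<in>S. u r)"
  have bdd: "bdd_above (u ` S)" using assms(1) by (rule bdd_aboveI2)
  have le: "u r \<le> B" if "r \<in> S" for r
    unfolding B_def using bdd that by (rule cSUP_upper2) simp
  have "0 \<le> B" using le[OF assms(3)] assms(2)[OF assms(3)] by simp
  have "B \<le> c + q * B"
    unfolding B_def using assms(3) step[OF le \<open>0 \<le> B\<close>] unfolding B_def by (intro cSUP_least) auto
  then have "B \<le> c / (1 - q)" using q by (simp add: field_simps)
  then show ?thesis using le[OF assms(3)] by simp
qed

text \<open>One estimate for both directions: \<open>S\<close> will be \<open>{r..t}\<close> when
  starting at \<open>t\<close>, and \<open>{..r}\<close> when starting at -infinity. The dominating
  function is nonnegative, so its integral may be enlarged to \<open>{..t}\<close>, which makes the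
  constants independent of \<open>S\<close>.\<close>

lemma integrable_estimate:
  assumes S: "S \<in> sets borel" "S \<subseteq> {..t}"
    and u: "u \<in> borel_measurable borel" "set_integrable lborel {..t} \<rho>"
    and le: "\<And>r. r \<in> S \<Longrightarrow> N (u r) \<le> \<phi> r * N (w r) + \<rho> r" "\<And>r. r \<le> t \<Longrightarrow> 0 \<le> \<rho> r"
    and B: "0 \<le> B" "\<And>r. r \<in> S \<Longrightarrow> N (w r) \<le> B"
  shows "set_integrable lborel S u"
    and "N (LINT r:S|lborel. u r) \<le> q * B + (LINT r:{..t}|lborel. \<rho> r)"
proof -
  have bnd: "set_integrable lborel {..t} (\<lambda>r. \<phi> r * B + \<rho> r)"
    using phi_int u(2) by (intro set_integral_add) auto
  then have bndS: "set_integrable lborel S (\<lambda>r. \<phi> r * B + \<rho> r)"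
    by (rule set_integrable_subset) (use S in auto)
  have le': "N (u r) \<le> \<phi> r * B + \<rho> r" if "r \<in> S" for r
    using le(1)[OF that] mult_left_mono[OF B(2)[OF that] phi_nonneg[of r]] by linarith
  show int: "set_integrable lborel S u"
    using u(1) bndS S(1) le' by (rule set_integrable_boundN)
  have "N (LINT r:S|lborel. u r) \<le> (LINT r:S|lborel. N (u r))"
    using int by (rule N_set_integral_le)
  also have "\<dots> \<le> (LINT r:S|lborel. \<phi> r * B + \<rho> r)"
    using set_integrable_N[OF int] bndS le' by (rule set_integral_mono)
  also have "\<dots> \<le> (LINT r:{..t}|lborel. \<phi> r * B + \<rho> r)"
    unfolding set_lebesgue_integral_def
    using bnd bndS S(2) phi_nonneg B(1) le(2)
    by (intro integral_mono) (auto simp: set_integrable_def split: split_indicator)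
  also have "\<dots> = q * B + (LINT r:{..t}|lborel. \<rho> r)"
    unfolding q_def using phi_int u(2) by (subst set_integral_add) auto
  finally show "N (LINT r:S|lborel. u r) \<le> q * B + (LINT r:{..t}|lborel. \<rho> r)" .
qed

text \<open>This is the limit of \<open>w\<close> at -infinity, by \<open>backward_tendsto\<close>.
  The integral form lets it be computed directly, for instance for a difference of two
  trajectories.\<close>

definition limit_value :: "(real \<Rightarrow> real^'n) \<Rightarrow> (real \<Rightarrow> real^'n) \<Rightarrow> real^'n" where
  "limit_value w u = w t - (LINT r:{..t}|lborel. u r)"

context
  fixes w u \<rho>
  assumes bw: "backward w u \<rho>"
begin

lemma
  shows backward_measurable: "u \<in> borel_measurable borel"
    and backward_continuous: "continuous_on {..t} w"
    and backward_eq: "s \<le> t \<Longrightarrow> w s = w t - (LINT r:{s..t}|lborel. u r)"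
    and backward_rho: "set_integrable lborel {..t} \<rho>" "r \<le> t \<Longrightarrow> 0 \<le> \<rho> r"
    and backward_le: "r \<le> t \<Longrightarrow> N (u r) \<le> \<phi> r * N (w r) + \<rho> r"
  using bw unfolding backward_def by blast+

text \<open>Continuity on the compact interval \<open>{s..t}\<close> supplies the crude bound for
  \<open>sup_absorb\<close>; the resulting bound no longer depends on \<open>s\<close>. That
  uniformity makes \<open>u\<close> integrable on the whole half-line.\<close>

lemma backward_bound:
  assumes "s \<le> t"
  shows "N (w s) \<le> (N (w t) + (LINT r:{..t}|lborel. \<rho> r)) / (1 - q)"
proof -
  have "continuous_on {s..t} w"
    by (rule continuous_on_subset[OF backward_continuous]) auto
  then have "compact ((\<lambda>r. N (w r)) ` {s..t})"
    by (intro compact_continuous_image continuous_intros compact_Icc)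
  then obtain B0 where B0: "\<And>r. r \<in> {s..t} \<Longrightarrow> N (w r) \<le> B0"
    by (meson bdd_above_def bounded_imp_bdd_above compact_imp_bounded imageI)
  show ?thesis
  proof (rule sup_absorb[where S = "{s..t}" and u = "\<lambda>r. N (w r)"])
    fix B r assume B: "\<And>r. r \<in> {s..t} \<Longrightarrow> N (w r) \<le> B" "0 \<le> B" and r: "r \<in> {s..t}"
    have "N (LINT r:{r..t}|lborel. u r) \<le> q * B + (LINT r:{..t}|lborel. \<rho> r)"
      by (rule integrable_estimate(2)[where w = w])
        (use B r backward_measurable backward_rho backward_le in auto)
    then have "N (w t - (LINT r:{r..t}|lborel. u r)) \<le> N (w t) + (LINT r:{..t}|lborel. \<rho> r) + q * B"
      using N_triangle_diff[of "w t" "LINT r:{r..t}|lborel. u r"] by simp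
    then show "N (w r) \<le> N (w t) + (LINT r:{..t}|lborel. \<rho> r) + q * B"
      using r by (subst backward_eq) auto
  qed (use B0 assms in auto)
qed

lemma backward_integrable: "set_integrable lborel {..t} u"
proof (rule integrable_estimate(1)[where w = w])
  show "N (w r) \<le> \<bar>(N (w t) + (LINT r:{..t}|lborel. \<rho> r)) / (1 - q)\<bar>" if "r \<in> {..t}" for r
    by (rule order_trans[OF backward_bound abs_ge_self]) (use that in simp)
qed (use backward_measurable backward_rho backward_le in auto)

lemma backward_tendsto: "(w \<longlongrightarrow> limit_value w u) at_bot"
proof -
  have "((\<lambda>s. w t - (LINT r:{s..t}|lborel. u r)) \<longlongrightarrow> limit_value w u) at_bot"
    unfolding limit_value_def using backward_integrable
    by (intro tendsto_intros tendsto_set_lebesgue_integral_at_bot) auto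
  moreover have "\<forall>\<^sub>F s in at_bot. w t - (LINT r:{s..t}|lborel. u r) = w s"
    using eventually_le_at_bot[of t] by eventually_elim (rule backward_eq[symmetric])
  ultimately show ?thesis by (rule Lim_transform_eventually)
qed

lemma backward_from_limit:
  assumes "s \<le> t"
  shows "w s = limit_value w u + (LINT r:{..s}|lborel. u r)"
proof -
  have "(LINT r:{..s} \<union> {s..t}|lborel. u r) = (LINT r:{..s}|lborel. u r) + (LINT r:{s..t}|lborel. u r)"
  proof (rule set_integral_Un_AE)
    show "AE r in lborel. \<not> (r \<in> {..s} \<and> r \<in> {s..t})"
      using AE_lborel_singleton[of s] by eventually_elim auto
    show "set_integrable lborel {..s} u" "set_integrable lborel {s..t} u"
      using assms by (auto intro!: set_integrable_subset[OF backward_integrable])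
  qed auto
  moreover have "{..s} \<union> {s..t} = {..t}" using assms by auto
  ultimately show ?thesis
    unfolding backward_eq[OF assms] limit_value_def by (simp add: algebra_simps)
qed

text \<open>The same absorption started at -infinity, with \<open>backward_bound\<close> as the
  crude bound. With zero defect, a solution whose limit is 0 vanishes identically; every injectivity
  claim about the limit map comes from this.\<close>

lemma backward_bound_from_limit:
  assumes "s \<le> t"
  shows "N (w s) \<le> (N (limit_value w u) + (LINT r:{..t}|lborel. \<rho> r)) / (1 - q)"
proof (rule sup_absorb[where S = "{..t}" and u = "\<lambda>r. N (w r)"])
  fix B r assume B: "\<And>r. r \<in> {..t} \<Longrightarrow> N (w r) \<le> B" "0 \<le> B" and r: "r \<in> {..t}"
  have "N (LINT r:{..r}|lborel. u r) \<le> q * B + (LINT r:{..t}|lborel. \<rho> r)"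
    by (rule integrable_estimate(2)[where w = w])
      (use B r backward_measurable backward_rho backward_le in auto)
  then have "N (limit_value w u + (LINT r:{..r}|lborel. u r))
      \<le> N (limit_value w u) + (LINT r:{..t}|lborel. \<rho> r) + q * B"
    using N_triangle[of "limit_value w u" "LINT r:{..r}|lborel. u r"] by simp
  then show "N (w r) \<le> N (limit_value w u) + (LINT r:{..t}|lborel. \<rho> r) + q * B"
    using backward_from_limit[of r] r by simp
next
  show "N (w r) \<le> (N (w t) + (LINT r:{..t}|lborel. \<rho> r)) / (1 - q)" if "r \<in> {..t}" for r
    using backward_bound that by simp
qed (use assms in auto)

end

end

section \<open>The limit of the flow at \<open>-\<infinity>\<close>\<close>

text \<open>A sequence, rather than a filter of increments, because measurability passes to
  sequential limits.\<close>

lemma tendsto_difference_quotient: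
  assumes "(k has_derivative D) (at x)"
  shows "(\<lambda>n. real (Suc n) *\<^sub>R (k (x + (1 / real (Suc n)) *\<^sub>R h) - k x)) \<longlonglongrightarrow> D h"
proof -
  have lin: "linear D" by (rule has_derivative_linear[OF assms])
  have "((\<lambda>\<tau>. k (x + \<tau> *\<^sub>R h)) has_derivative (\<lambda>\<tau>. D (\<tau> *\<^sub>R h))) (at 0)"
    by (rule has_derivative_compose[of "\<lambda>\<tau>. x + \<tau> *\<^sub>R h" "\<lambda>\<tau>. \<tau> *\<^sub>R h" 0 UNIV k D])
      (use assms in \<open>auto intro!: derivative_eq_intros\<close>)
  then have "(\<lambda>\<tau>. norm (k (x + \<tau> *\<^sub>R h) - k x - \<tau> *\<^sub>R D h) / norm \<tau>) \<midarrow>0\<rightarrow> 0"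
    unfolding has_derivative_at by (simp add: linear_scale[OF lin])
  moreover have "filterlim (\<lambda>n. 1 / real (Suc n)) (at 0) sequentially"
  proof (rule filterlim_atI)
    show "(\<lambda>n. 1 / real (Suc n)) \<longlonglongrightarrow> 0"
      using LIMSEQ_inverse_real_of_nat by (simp add: inverse_eq_divide)
  qed auto
  ultimately have "(\<lambda>n. norm (k (x + (1 / real (Suc n)) *\<^sub>R h) - k x - (1 / real (Suc n)) *\<^sub>R D h)
      / norm (1 / real (Suc n))) \<longlonglongrightarrow> 0"
    by (rule filterlim_compose)
  moreover have "norm (k (x + (1 / real (Suc n)) *\<^sub>R h) - k x - (1 / real (Suc n)) *\<^sub>R D h)
      / norm (1 / real (Suc n))
    = norm (real (Suc n) *\<^sub>R (k (x + (1 / real (Suc n)) *\<^sub>R h) - k x) - D h)" for n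
  proof -
    define c where "c = real (Suc n)"
    have c: "0 < c" by (simp add: c_def)
    have "real (Suc n) *\<^sub>R (k (x + (1 / real (Suc n)) *\<^sub>R h) - k x) - D h
      = c *\<^sub>R (k (x + (1 / c) *\<^sub>R h) - k x - (1 / c) *\<^sub>R D h)"
      unfolding c_def[symmetric] using c by (simp add: scaleR_diff_right)
    then show ?thesis unfolding c_def[symmetric] using c by (simp add: mult.commute)
  qed
  ultimately have "(\<lambda>n. real (Suc n) *\<^sub>R (k (x + (1 / real (Suc n)) *\<^sub>R h) - k x) - D h) \<longlonglongrightarrow> 0"
    by (simp add: tendsto_norm_zero_iff)
  then show ?thesis by (simp only: LIM_zero_iff)
qed

lemma bounded_linear_matrix_vector_left: "bounded_linear (\<lambda>B. B *v w)"
  for w :: "real^'n::finite"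
  by (rule linear_conv_bounded_linear[THEN iffD1], rule linearI)
    (auto simp: matrix_vector_mult_add_rdistrib scaleR_matrix_vector_assoc)

lemma bounded_bilinear_matrix_vector_mult:
  "bounded_bilinear ((*v) :: real^'n^'m \<Rightarrow> real^'n \<Rightarrow> real^'m)"
  by (intro bilinear_conv_bounded_bilinear[THEN iffD1])
    (auto simp: bilinear_def bounded_linear.linear bounded_linear_matrix_vector_left)

lemmas tendsto_matrix_vector_mult [tendsto_intros] =
  bounded_bilinear.tendsto[OF bounded_bilinear_matrix_vector_mult]
lemmas continuous_on_matrix_vector_mult [continuous_intros] =
  bounded_bilinear.continuous_on[OF bounded_bilinear_matrix_vector_mult]

lemma tendsto_det [tendsto_intros]:
  "(F \<longlongrightarrow> L) G \<Longrightarrow> ((\<lambda>x. det (F x :: real^'n^'n)) \<longlongrightarrow> det L) G"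
  unfolding det_def by (intro tendsto_intros)

lemma matrix_vector_mult_sum_axis: "B *v h = (\<Sum>i\<in>UNIV. (h $ i) *\<^sub>R (B *v axis i 1))"
  for B :: "real^'n^'m"
  unfolding matrix_vector_mult_basis by (simp add: matrix_mult_sum scalar_mult_eq_scaleR)

lemma bounded_bilinear_matrix_mult:
  "bounded_bilinear ((**) :: real^'n^'n \<Rightarrow> real^'n^'n \<Rightarrow> real^'n^'n)"
proof (rule bilinear_conv_bounded_bilinear[THEN iffD1], unfold bilinear_def, intro conjI allI)
  fix x :: "real^'n^'n"
  show "linear ((**) x)" "linear (\<lambda>y. y ** x)"
    by (auto intro!: linearI simp: matrix_add_ldistrib matrix_matrix_mult_def vec_eq_iff
        sum.distrib sum_distrib_left algebra_simps)
qed

lemma matrix_inv_cancel: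
  assumes "invertible (A :: real^'n^'n)"
  shows "matrix_inv A ** A = mat 1" "A ** matrix_inv A = mat 1"
  using someI_ex[OF assms[unfolded invertible_def]] by (auto simp: matrix_inv_def)

text \<open>The system after the substitution that removes the linear part: \<open>\<phi>\<close>
  gives contraction, \<open>b\<close> integrability along trajectories. Nothing is assumed about how
  \<open>Dg\<close> depends on time, which is why \<open>Z\<close> enters in integrated
  form.\<close>

locale half_line_flow = contraction N t \<phi>
  for N :: "real^'n \<Rightarrow> real" and t \<phi> +
  fixes g :: "real \<Rightarrow> real^'n \<Rightarrow> real^'n" and Dg :: "real \<Rightarrow> real^'n \<Rightarrow> real^'n^'n"
    and v :: "real \<Rightarrow> real^'n \<Rightarrow> real^'n" and Z :: "real^'n \<Rightarrow> real \<Rightarrow> real^'n^'n"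
    and b :: "real \<Rightarrow> real"
  assumes g_cont: "continuous_on UNIV (\<lambda>(r, x). g r x)"
    and g_deriv: "\<And>r x. (g r has_derivative (*v) (Dg r x)) (at x)"
    and g_lip: "\<And>r x x'. r \<le> t \<Longrightarrow> N (g r x - g r x') \<le> \<phi> r * N (x - x')"
    and g_bound: "\<And>r x. r \<le> t \<Longrightarrow> N (g r x) \<le> b r"
    and b_int: "set_integrable lborel {..t} b"
    and v_deriv: "\<And>r \<eta>. ((\<lambda>r. v r \<eta>) has_vector_derivative g r (v r \<eta>)) (at r)"
    and v_t: "\<And>\<eta>. v t \<eta> = \<eta>"
    and Z_t: "\<And>\<eta>. Z \<eta> t = mat 1"
    and Z_int: "\<And>\<eta>. fundamental_matrix_int (\<lambda>r. Dg r (v r \<eta>)) (Z \<eta>)"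
begin

definition G :: "real^'n \<Rightarrow> real^'n" where
  "G \<eta> = \<eta> - (LINT r:{..t}|lborel. g r (v r \<eta>))"

lemma continuous_on_g: "continuous_on S p \<Longrightarrow> continuous_on S (\<lambda>r. g r (p r))"
  using continuous_on_compose2[OF g_cont, of S "\<lambda>r. (r, p r)"] by (simp add: continuous_on_Pair)

lemma continuous_on_v: "continuous_on S (\<lambda>r. v r \<eta>)"
  by (intro continuous_at_imp_continuous_on ballI has_vector_derivative_continuous[OF v_deriv])

lemma continuous_on_gv: "continuous_on S (\<lambda>r. g r (v r \<eta>))"
  by (intro continuous_on_g continuous_on_v)

lemma measurable_gv [measurable]: "(\<lambda>r. g r (v r \<eta>)) \<in> borel_measurable borel"
  by (intro borel_measurable_continuous_onI continuous_on_gv)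

lemma v_eq:
  assumes "s \<le> t"
  shows "v s \<eta> = \<eta> - (LINT r:{s..t}|lborel. g r (v r \<eta>))"
proof -
  have "(LINT r:{s..t}|lborel. g r (v r \<eta>)) = v t \<eta> - v s \<eta>"
    unfolding set_lebesgue_integral_def
    by (rule integral_FTC_Icc[where F = "\<lambda>r. v r \<eta>", OF assms
          has_vector_derivative_at_within[OF v_deriv] continuous_on_gv])
  then show ?thesis by (simp add: v_t)
qed

lemma integrable_gv: "set_integrable lborel {..t} (\<lambda>r. g r (v r \<eta>))"
  using measurable_gv b_int g_bound by (intro set_integrable_boundN) auto

lemma integrable_gv_Icc: "set_integrable lborel {s..t} (\<lambda>r. g r (v r \<eta>))"
  by (rule set_integrable_subset[OF integrable_gv]) auto

text \<open>A pointwise limit of difference quotients of \<open>g\<close>, each continuous in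
  time.\<close>

lemma measurable_Dg:
  assumes "continuous_on UNIV p"
  shows "(\<lambda>r. Dg r (v r \<eta>) *v p r) \<in> borel_measurable borel"
proof -
  let ?k = "\<lambda>n r. real (Suc n) *\<^sub>R (g r (v r \<eta> + (1 / real (Suc n)) *\<^sub>R p r) - g r (v r \<eta>))"
  show ?thesis
  proof (rule borel_measurable_LIMSEQ_metric)
    show "?k n \<in> borel_measurable borel" for n
      by (intro borel_measurable_continuous_onI continuous_intros continuous_on_g continuous_on_v assms)
    show "(\<lambda>n. ?k n r) \<longlonglongrightarrow> Dg r (v r \<eta>) *v p r" for r
      by (rule tendsto_difference_quotient[OF g_deriv])
  qed
qed

text \<open>The Lipschitz estimate passes to difference quotients and then to their limit, so the
  derivative inherits the same weight \<open>\<phi>\<close>.\<close>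

lemma N_Dg_le:
  assumes "r \<le> t"
  shows "N (Dg r x *v h) \<le> \<phi> r * N h"
proof (rule LIMSEQ_le_const2)
  show "(\<lambda>n. N (real (Suc n) *\<^sub>R (g r (x + (1 / real (Suc n)) *\<^sub>R h) - g r x))) \<longlonglongrightarrow> N (Dg r x *v h)"
    by (rule tendsto_N[OF tendsto_difference_quotient[OF g_deriv]])
  have "N (real (Suc n) *\<^sub>R (g r (x + (1 / real (Suc n)) *\<^sub>R h) - g r x)) \<le> \<phi> r * N h" for n
  proof -
    have "N (g r (x + (1 / real (Suc n)) *\<^sub>R h) - g r x) \<le> \<phi> r * N ((1 / real (Suc n)) *\<^sub>R h)"
      using g_lip[OF assms, of "x + (1 / real (Suc n)) *\<^sub>R h" x] by (simp only: add_diff_cancel_left')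
    then have "real (Suc n) * N (g r (x + (1 / real (Suc n)) *\<^sub>R h) - g r x)
        \<le> real (Suc n) * (\<phi> r * (\<bar>1 / real (Suc n)\<bar> * N h))"
      unfolding N_scaleR by (intro mult_left_mono) auto
    then show ?thesis unfolding N_scaleR by simp
  qed
  then show "\<exists>M. \<forall>n\<ge>M. N (real (Suc n) *\<^sub>R (g r (x + (1 / real (Suc n)) *\<^sub>R h) - g r x)) \<le> \<phi> r * N h"
    by blast
qed

section \<open>The fundamental matrix and its limit at -infinity\<close>

lemma isCont_Z: "isCont (Z \<eta>) r"
proof -
  let ?F = "\<lambda>r. Dg r (v r \<eta>) ** Z \<eta> r"
  have int: "(?F has_integral (Z \<eta> b - Z \<eta> a)) {a..b}" if "a \<le> b" for a b
    using Z_int that unfolding fundamental_matrix_int_def by blast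
  \<comment> \<open>Around \<open>r\<close>, \<open>Z\<close> is an indefinite integral based at
    \<open>r - 1\<close>; the window keeps \<open>r\<close> in its interior.\<close>
  have "continuous_on {r-1..r+1} (\<lambda>x. Z \<eta> (r-1) + integral {r-1..x} ?F)"
    using int[of "r-1" "r+1"] by (intro continuous_intros indefinite_integral_continuous_1) auto
  moreover have "Z \<eta> (r-1) + integral {r-1..x} ?F = Z \<eta> x" if "x \<in> {r-1..r+1}" for x
    using integral_unique[OF int[of "r-1" x]] that by simp
  ultimately have "continuous_on {r-1..r+1} (Z \<eta>)"
    by (rule continuous_on_eq)
  then show ?thesis
    by (rule continuous_on_interior) simp
qed

lemma continuous_on_Z: "continuous_on S (Z \<eta>)"
  by (simp add: continuous_at_imp_continuous_on isCont_Z)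

lemma continuous_on_Zw: "continuous_on S (\<lambda>r. Z \<eta> r *v w)"
  by (intro continuous_intros continuous_on_Z)

lemma measurable_DgZ: "(\<lambda>r. Dg r (v r \<eta>) *v (Z \<eta> r *v w)) \<in> borel_measurable borel"
  by (intro measurable_Dg continuous_on_Zw)

text \<open>The equation for \<open>Z\<close> is stated with the gauge integral; this integrability
  allows it to be read as a Lebesgue integral.\<close>

lemma integrable_DgZ_Icc:
  "set_integrable lborel {s..t} (\<lambda>r. Dg r (v r \<eta>) *v (Z \<eta> r *v w))"
proof -
  have "compact ((\<lambda>r. N (Z \<eta> r *v w)) ` {s..t})"
    by (intro compact_continuous_image continuous_intros continuous_on_Z compact_Icc)
  then obtain B where B: "\<And>r. r \<in> {s..t} \<Longrightarrow> N (Z \<eta> r *v w) \<le> B"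
    by (meson bdd_above_def bounded_imp_bdd_above compact_imp_bounded imageI)
  show ?thesis
  proof (rule integrable_estimate(1)[where w = "\<lambda>r. Z \<eta> r *v w" and \<rho> = "\<lambda>_. 0" and B = "\<bar>B\<bar>"])
    show "N (Z \<eta> r *v w) \<le> \<bar>B\<bar>" if "r \<in> {s..t}" for r
      using B[OF that] by simp
  qed (auto simp: measurable_DgZ N_Dg_le set_integrable_def)
qed

text \<open>The matrix equation is applied to a fixed vector, since the contraction estimates
  concern vectors. The linear equation has no defect.\<close>

lemma backward_Z: "backward (\<lambda>r. Z \<eta> r *v w) (\<lambda>r. Dg r (v r \<eta>) *v (Z \<eta> r *v w)) (\<lambda>_. 0)"
  unfolding backward_def
proof (intro conjI allI impI)
  fix s assume s: "s \<le> t"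
  have "((\<lambda>B. B *v w) \<circ> (\<lambda>r. Dg r (v r \<eta>) ** Z \<eta> r) has_integral (Z \<eta> t - Z \<eta> s) *v w) {s..t}"
    using Z_int s unfolding fundamental_matrix_int_def
    by (intro has_integral_linear bounded_linear_matrix_vector_left) blast
  then have "((\<lambda>r. Dg r (v r \<eta>) *v (Z \<eta> r *v w)) has_integral (Z \<eta> t *v w - Z \<eta> s *v w)) {s..t}"
    by (simp add: o_def matrix_vector_mul_assoc matrix_vector_mult_diff_rdistrib)
  then have "(LINT r:{s..t}|lborel. Dg r (v r \<eta>) *v (Z \<eta> r *v w)) = Z \<eta> t *v w - Z \<eta> s *v w"
    using set_borel_integral_eq_integral(2)[OF integrable_DgZ_Icc] integral_unique by simp
  then show "Z \<eta> s *v w = Z \<eta> t *v w - (LINT r:{s..t}|lborel. Dg r (v r \<eta>) *v (Z \<eta> r *v w))"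
    by simp
qed (auto simp: measurable_DgZ continuous_on_Zw N_Dg_le set_integrable_def)

definition Zinf :: "real^'n \<Rightarrow> real^'n^'n" where
  "Zinf \<eta> = (\<chi> i j. limit_value (\<lambda>r. Z \<eta> r *v axis j 1)
     (\<lambda>r. Dg r (v r \<eta>) *v (Z \<eta> r *v axis j 1)) $ i)"

lemma Z_tendsto: "(Z \<eta> \<longlongrightarrow> Zinf \<eta>) at_bot"
proof (intro vec_tendstoI)
  fix i j
  have "((\<lambda>r. (Z \<eta> r *v axis j 1) $ i) \<longlongrightarrow> Zinf \<eta> $ i $ j) at_bot"
    using tendsto_vec_nth[OF backward_tendsto[OF backward_Z[of \<eta> "axis j 1"]], of i] by (simp add: Zinf_def)
  then show "((\<lambda>r. Z \<eta> r $ i $ j) \<longlongrightarrow> Zinf \<eta> $ i $ j) at_bot"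
    by (simp add: matrix_vector_mult_basis column_def)
qed

lemma Zinf_eq_limit_value:
  "Zinf \<eta> *v w = limit_value (\<lambda>r. Z \<eta> r *v w) (\<lambda>r. Dg r (v r \<eta>) *v (Z \<eta> r *v w))"
proof (rule tendsto_unique)
  show "((\<lambda>r. Z \<eta> r *v w) \<longlongrightarrow> Zinf \<eta> *v w) at_bot"
    by (intro tendsto_intros Z_tendsto)
  show "((\<lambda>r. Z \<eta> r *v w) \<longlongrightarrow>
      limit_value (\<lambda>r. Z \<eta> r *v w) (\<lambda>r. Dg r (v r \<eta>) *v (Z \<eta> r *v w))) at_bot"
    by (rule backward_tendsto[OF backward_Z])
qed simp

lemma det_Z_pos:
  assumes "s \<le> t"
  shows "0 < det (Z \<eta> s)"
proof (rule ccontr)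
  assume "\<not> 0 < det (Z \<eta> s)"
  moreover have "continuous_on {s..t} (\<lambda>r. det (Z \<eta> r))"
    using continuous_on_Z by (auto simp: continuous_on_def intro!: tendsto_intros)
  ultimately obtain r where "det (Z \<eta> r) = 0"
    using IVT'[of "\<lambda>r. det (Z \<eta> r)" s 0 t] assms by (auto simp: Z_t not_less)
  moreover have "invertible (Z \<eta> r)"
    using Z_int unfolding fundamental_matrix_int_def by blast
  ultimately show False by (simp add: invertible_det_nz)
qed

lemma det_Zinf_pos: "0 < det (Zinf \<eta>)"
proof -
  have "0 \<le> det (Zinf \<eta>)"
  proof (rule tendsto_lowerbound)
    show "((\<lambda>s. det (Z \<eta> s)) \<longlongrightarrow> det (Zinf \<eta>)) at_bot"
      by (intro tendsto_intros Z_tendsto)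
    show "\<forall>\<^sub>F s in at_bot. 0 \<le> det (Z \<eta> s)"
      using eventually_le_at_bot[of t] by eventually_elim (simp add: det_Z_pos less_imp_le)
  qed simp
  \<comment> \<open>The limit of determinants only yields \<open>\<ge>\<close>. For strictness, a
    vector in the kernel gives a solution with limit 0, and the bound from -infinity at time
    \<open>t\<close>, where \<open>Z\<close> is the identity, forces \<open>w = 0\<close>.\<close>
  moreover have "w = 0" if "Zinf \<eta> *v w = 0" for w
    using backward_bound_from_limit[OF backward_Z order_refl, of \<eta> w] that
    by (simp add: Zinf_eq_limit_value[symmetric] Z_t set_lebesgue_integral_def antisym[OF _ N_nonneg]
        flip: N_eq_0_iff)
  then have "det (Zinf \<eta>) \<noteq> 0"
    unfolding invertible_det_nz[symmetric] invertible_left_inverse matrix_left_invertible_ker by blast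
  ultimately show ?thesis by simp
qed

lemma backward_diff:
  "backward (\<lambda>r. v r \<eta>' - v r \<eta>) (\<lambda>r. g r (v r \<eta>') - g r (v r \<eta>)) (\<lambda>_. 0)"
  unfolding backward_def
proof (intro conjI allI impI)
  fix s assume s: "s \<le> t"
  show "v s \<eta>' - v s \<eta> = v t \<eta>' - v t \<eta> - (LINT r:{s..t}|lborel. g r (v r \<eta>') - g r (v r \<eta>))"
    unfolding v_eq[OF s] v_t
    by (subst set_integral_diff(2)[OF integrable_gv_Icc integrable_gv_Icc]) simp
  show "N (g s (v s \<eta>') - g s (v s \<eta>)) \<le> \<phi> s * N (v s \<eta>' - v s \<eta>) + 0"
    using g_lip[OF s] by simp
qed (auto simp: set_integrable_def intro!: continuous_intros continuous_on_v)

lemma limit_value_diff: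
  "limit_value (\<lambda>r. v r \<eta>' - v r \<eta>) (\<lambda>r. g r (v r \<eta>') - g r (v r \<eta>)) = G \<eta>' - G \<eta>"
  unfolding limit_value_def G_def v_t
  by (subst set_integral_diff(2)[OF integrable_gv integrable_gv]) simp

lemma v_lipschitz: "s \<le> t \<Longrightarrow> N (v s \<eta>' - v s \<eta>) \<le> N (\<eta>' - \<eta>) / (1 - q)"
  using backward_bound[OF backward_diff, of s] by (simp add: v_t set_lebesgue_integral_def)

lemma inj_G: "inj G"
proof (rule injI)
  fix \<eta>' \<eta> assume "G \<eta>' = G \<eta>"
  then have "N (\<eta>' - \<eta>) \<le> 0"
    using backward_bound_from_limit[OF backward_diff order_refl, of \<eta>' \<eta>]
    by (simp add: limit_value_diff v_t set_lebesgue_integral_def)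
  then have "N (\<eta>' - \<eta>) = 0" by (intro antisym N_nonneg)
  then show "\<eta>' = \<eta>" by simp
qed

section \<open>Differentiability of the limit map\<close>

definition remainder :: "real^'n \<Rightarrow> real^'n \<Rightarrow> real \<Rightarrow> real" where
  "remainder \<eta> \<eta>' r = N (g r (v r \<eta>') - g r (v r \<eta>) - Dg r (v r \<eta>) *v (v r \<eta>' - v r \<eta>))"

lemma measurable_remainder [measurable]: "remainder \<eta> \<eta>' \<in> borel_measurable borel"
proof -
  have [measurable]: "(\<lambda>r. Dg r (v r \<eta>) *v (v r \<eta>' - v r \<eta>)) \<in> borel_measurable borel"
    by (intro measurable_Dg continuous_intros continuous_on_v)
  show ?thesis unfolding remainder_def[abs_def] by measurable
qed

text \<open>The factor 2 counts the increment of \<open>g\<close> and its linear part, each bounded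
  through \<open>\<phi>\<close>. Being linear in \<open>N (\<eta>' - \<eta>)\<close>, the bound
  still dominates after division by the increment.\<close>

lemma remainder_le:
  assumes "r \<le> t"
  shows "remainder \<eta> \<eta>' r \<le> \<phi> r * (2 * (N (\<eta>' - \<eta>) / (1 - q)))"
proof -
  have "remainder \<eta> \<eta>' r \<le> \<phi> r * N (v r \<eta>' - v r \<eta>) + \<phi> r * N (v r \<eta>' - v r \<eta>)"
    unfolding remainder_def using assms
    by (intro order_trans[OF N_triangle_diff] add_mono g_lip N_Dg_le)
  also have "\<dots> = \<phi> r * (2 * N (v r \<eta>' - v r \<eta>))" by simp
  also have "\<dots> \<le> \<phi> r * (2 * (N (\<eta>' - \<eta>) / (1 - q)))"
    using v_lipschitz[OF assms] phi_nonneg by (intro mult_left_mono) auto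
  finally show ?thesis .
qed

lemma remainder_nonneg: "0 \<le> remainder \<eta> \<eta>' r"
  by (simp add: remainder_def)

lemma integrable_remainder: "set_integrable lborel {..t} (remainder \<eta> \<eta>')"
proof (rule set_integrable_bound)
  show "set_integrable lborel {..t} (\<lambda>r. \<phi> r * (2 * (N (\<eta>' - \<eta>) / (1 - q))))"
    using phi_int by (rule set_integrable_mult_left)
  show "set_borel_measurable lborel {..t} (remainder \<eta> \<eta>')"
    unfolding set_borel_measurable_def by measurable
  show "AE r in lborel. r \<in> {..t} \<longrightarrow>
      norm (remainder \<eta> \<eta>' r) \<le> norm (\<phi> r * (2 * (N (\<eta>' - \<eta>) / (1 - q))))"
  proof (intro AE_I2 impI)
    fix r assume "r \<in> {..t}"
    then have "remainder \<eta> \<eta>' r \<le> \<phi> r * (2 * (N (\<eta>' - \<eta>) / (1 - q)))"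
      by (intro remainder_le) simp
    then show "norm (remainder \<eta> \<eta>' r) \<le> norm (\<phi> r * (2 * (N (\<eta>' - \<eta>) / (1 - q))))"
      unfolding real_norm_def abs_of_nonneg[OF remainder_nonneg] by linarith
  qed
qed

lemma backward_second_diff:
  "backward (\<lambda>r. v r \<eta>' - v r \<eta> - Z \<eta> r *v (\<eta>' - \<eta>))
     (\<lambda>r. g r (v r \<eta>') - g r (v r \<eta>) - Dg r (v r \<eta>) *v (Z \<eta> r *v (\<eta>' - \<eta>))) (remainder \<eta> \<eta>')"
  unfolding backward_def
proof (intro conjI allI impI)
  show "(\<lambda>r. g r (v r \<eta>') - g r (v r \<eta>) - Dg r (v r \<eta>) *v (Z \<eta> r *v (\<eta>' - \<eta>)))
      \<in> borel_measurable borel"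
    using measurable_DgZ[of \<eta> "\<eta>' - \<eta>"] by measurable
  show "continuous_on {..t} (\<lambda>r. v r \<eta>' - v r \<eta> - Z \<eta> r *v (\<eta>' - \<eta>))"
    by (intro continuous_intros continuous_on_v continuous_on_Z)
  fix s assume s: "s \<le> t"
  have e1: "v s \<eta>' - v s \<eta> = v t \<eta>' - v t \<eta> - (LINT r:{s..t}|lborel. g r (v r \<eta>') - g r (v r \<eta>))"
    using backward_eq[OF backward_diff s] .
  have e2: "Z \<eta> s *v (\<eta>' - \<eta>) = Z \<eta> t *v (\<eta>' - \<eta>)
      - (LINT r:{s..t}|lborel. Dg r (v r \<eta>) *v (Z \<eta> r *v (\<eta>' - \<eta>)))"
    using backward_eq[OF backward_Z s] .
  have e3: "(LINT r:{s..t}|lborel. g r (v r \<eta>') - g r (v r \<eta>) - Dg r (v r \<eta>) *v (Z \<eta> r *v (\<eta>' - \<eta>)))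
    = (LINT r:{s..t}|lborel. g r (v r \<eta>') - g r (v r \<eta>))
      - (LINT r:{s..t}|lborel. Dg r (v r \<eta>) *v (Z \<eta> r *v (\<eta>' - \<eta>)))"
    by (intro set_integral_diff(2) set_integral_diff(1) integrable_gv_Icc integrable_DgZ_Icc)
  have e4: "x - i - (y - j) = x - y - (i - j)" for x y i j :: "real^'n" by simp
  show "v s \<eta>' - v s \<eta> - Z \<eta> s *v (\<eta>' - \<eta>) = v t \<eta>' - v t \<eta> - Z \<eta> t *v (\<eta>' - \<eta>)
    - (LINT r:{s..t}|lborel. g r (v r \<eta>') - g r (v r \<eta>) - Dg r (v r \<eta>) *v (Z \<eta> r *v (\<eta>' - \<eta>)))"
    unfolding e1 e2 e3 by (rule e4)
  \<comment> \<open>Adding and subtracting the derivative applied to the true increment separates a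
    term linear in the error from the Taylor remainder, which becomes the defect.\<close>
  have split: "g s (v s \<eta>') - g s (v s \<eta>) - Dg s (v s \<eta>) *v (Z \<eta> s *v (\<eta>' - \<eta>))
    = Dg s (v s \<eta>) *v (v s \<eta>' - v s \<eta> - Z \<eta> s *v (\<eta>' - \<eta>))
      + (g s (v s \<eta>') - g s (v s \<eta>) - Dg s (v s \<eta>) *v (v s \<eta>' - v s \<eta>))"
    by (simp add: matrix_vector_mult_diff_distrib)
  show "N (g s (v s \<eta>') - g s (v s \<eta>) - Dg s (v s \<eta>) *v (Z \<eta> s *v (\<eta>' - \<eta>)))
    \<le> \<phi> s * N (v s \<eta>' - v s \<eta> - Z \<eta> s *v (\<eta>' - \<eta>)) + remainder \<eta> \<eta>' s"
    unfolding remainder_def split by (rule order_trans[OF N_triangle add_right_mono[OF N_Dg_le[OF s]]])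
qed (rule integrable_remainder remainder_nonneg)+

end

context half_line_flow
begin

text \<open>The error vanishes at \<open>t\<close>, so \<open>backward_bound\<close> leaves only the
  integral of the defect; then the time goes to -infinity.\<close>

lemma G_diff_le:
  "N (G \<eta>' - G \<eta> - Zinf \<eta> *v (\<eta>' - \<eta>)) \<le> (LINT r:{..t}|lborel. remainder \<eta> \<eta>' r) / (1 - q)"
proof (rule tendsto_upperbound)
  have "((\<lambda>r. v r \<eta>' - v r \<eta>) \<longlongrightarrow> G \<eta>' - G \<eta>) at_bot"
    using backward_tendsto[OF backward_diff] by (simp add: limit_value_diff)
  then show "((\<lambda>r. N (v r \<eta>' - v r \<eta> - Z \<eta> r *v (\<eta>' - \<eta>)))
      \<longlongrightarrow> N (G \<eta>' - G \<eta> - Zinf \<eta> *v (\<eta>' - \<eta>))) at_bot"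
    by (intro tendsto_N tendsto_diff[of "\<lambda>r. v r \<eta>' - v r \<eta>"] tendsto_matrix_vector_mult Z_tendsto
        tendsto_const)
  show "\<forall>\<^sub>F r in at_bot. N (v r \<eta>' - v r \<eta> - Z \<eta> r *v (\<eta>' - \<eta>))
      \<le> (LINT r:{..t}|lborel. remainder \<eta> \<eta>' r) / (1 - q)"
    using eventually_le_at_bot[of t]
    by eventually_elim (use backward_bound[OF backward_second_diff] in \<open>simp add: v_t Z_t\<close>)
qed simp

lemma remainder_tendsto:
  assumes "h \<longlonglongrightarrow> \<eta>" "\<And>n. h n \<noteq> \<eta>" and r: "r \<le> t"
  shows "(\<lambda>n. remainder \<eta> (h n) r / norm (h n - \<eta>)) \<longlonglongrightarrow> 0"
proof -
  obtain C where C: "0 < C" "\<And>x. N x \<le> C * norm x" using N_le_norm by blast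
  obtain c where c: "0 < c" "\<And>x. norm x \<le> c * N x" using norm_le_N by blast
  define L where "L = c * C / (1 - q)"
  have L: "0 < L" using C c q by (simp add: L_def)
  have vL: "norm (v r \<eta>' - v r \<eta>) \<le> L * norm (\<eta>' - \<eta>)" for \<eta>'
  proof -
    have "norm (v r \<eta>' - v r \<eta>) \<le> c * (N (\<eta>' - \<eta>) / (1 - q))"
      using c v_lipschitz[OF r] by (meson mult_left_mono less_imp_le order_trans)
    also have "\<dots> \<le> c * ((C * norm (\<eta>' - \<eta>)) / (1 - q))"
      using c C q by (intro mult_left_mono divide_right_mono) auto
    finally show ?thesis by (simp add: L_def)
  qed
  show ?thesis
  proof (rule LIMSEQ_I)
    fix e :: real assume e: "0 < e"
    \<comment> \<open>\<open>L\<close> is the Lipschitz constant of the flow and \<open>C\<close>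
      compares \<open>N\<close> with the Euclidean norm, so the final estimate is
      \<open>e / 2\<close>, which leaves room for a strict inequality.\<close>
    define e' where "e' = e / (2 * C * L)"
    have e': "0 < e'" using e C L by (simp add: e'_def)
    obtain d where d: "0 < d" "\<And>y. norm (y - v r \<eta>) < d \<Longrightarrow>
        norm (g r y - g r (v r \<eta>) - Dg r (v r \<eta>) *v (y - v r \<eta>)) \<le> e' * norm (y - v r \<eta>)"
      using g_deriv[of r "v r \<eta>"] e' unfolding has_derivative_at_alt by blast
    have "0 < d / L" using d L by simp
    then obtain n0 where n0: "\<And>n. n \<ge> n0 \<Longrightarrow> norm (h n - \<eta>) < d / L"
      using LIMSEQ_D[OF assms(1)] by blast
    have "norm (remainder \<eta> (h n) r / norm (h n - \<eta>) - 0) < e" if "n \<ge> n0" for n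
    proof -
      have pos: "0 < norm (h n - \<eta>)" using assms(2) by simp
      have "L * norm (h n - \<eta>) < d" using n0[OF that] L by (simp add: field_simps)
      then have "norm (v r (h n) - v r \<eta>) < d" using vL[of "h n"] by simp
      then have "norm (g r (v r (h n)) - g r (v r \<eta>) - Dg r (v r \<eta>) *v (v r (h n) - v r \<eta>))
          \<le> e' * norm (v r (h n) - v r \<eta>)" by (rule d)
      also have "\<dots> \<le> e' * (L * norm (h n - \<eta>))" using vL e' by simp
      finally have "remainder \<eta> (h n) r \<le> C * (e' * (L * norm (h n - \<eta>)))"
        unfolding remainder_def using C by (meson mult_left_mono less_imp_le order_trans)
      also have "\<dots> = (e / 2) * norm (h n - \<eta>)" using C L by (simp add: e'_def)
      also have "\<dots> < e * norm (h n - \<eta>)" using e pos by simp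
      finally show ?thesis using pos remainder_nonneg by (simp add: field_simps)
    qed
    then show "\<exists>n0. \<forall>n\<ge>n0. norm (remainder \<eta> (h n) r / norm (h n - \<eta>) - 0) < e" by blast
  qed
qed

text \<open>Dominated convergence with a fixed multiple of \<open>\<phi>\<close> as majorant. It
  concerns sequences, so the derivative of \<open>G\<close> is tested along sequences as
  well.\<close>

lemma remainder_integral_tendsto:
  assumes h: "h \<longlonglongrightarrow> \<eta>" "\<And>n. h n \<noteq> \<eta>"
  shows "(\<lambda>n. (LINT r:{..t}|lborel. remainder \<eta> (h n) r) / norm (h n - \<eta>)) \<longlonglongrightarrow> 0"
proof -
  obtain C where C: "0 < C" "\<And>x. N x \<le> C * norm x" using N_le_norm by blast
  have "(\<lambda>n. LINT r|lborel. indicator {..t} r *\<^sub>R (remainder \<eta> (h n) r / norm (h n - \<eta>)))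
      \<longlonglongrightarrow> integral\<^sup>L lborel (\<lambda>_::real. 0::real)"
  proof (rule integral_dominated_convergence[where
        w = "\<lambda>r. indicator {..t} r *\<^sub>R (\<phi> r * (2 * C / (1 - q)))"])
    show "integrable lborel (\<lambda>r. indicator {..t} r *\<^sub>R (\<phi> r * (2 * C / (1 - q))))"
    proof -
      have "set_integrable lborel {..t} (\<lambda>r. \<phi> r * (2 * C / (1 - q)))"
        using phi_int by (rule set_integrable_mult_left)
      then show ?thesis unfolding set_integrable_def .
    qed
    show "AE r in lborel. (\<lambda>n. indicator {..t} r *\<^sub>R (remainder \<eta> (h n) r / norm (h n - \<eta>)))
        \<longlonglongrightarrow> 0"
      using remainder_tendsto[OF h] by (intro AE_I2) (auto split: split_indicator)
    show "AE r in lborel. norm (indicator {..t} r *\<^sub>R (remainder \<eta> (h n) r / norm (h n - \<eta>)))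
        \<le> indicator {..t} r *\<^sub>R (\<phi> r * (2 * C / (1 - q)))" for n
    proof (rule AE_I2)
      fix r
      have "remainder \<eta> (h n) r / norm (h n - \<eta>) \<le> \<phi> r * (2 * C / (1 - q))" if "r \<le> t"
      proof -
        have "remainder \<eta> (h n) r \<le> \<phi> r * (2 * (N (h n - \<eta>) / (1 - q)))"
          by (rule remainder_le[OF that])
        also have "\<dots> \<le> \<phi> r * (2 * ((C * norm (h n - \<eta>)) / (1 - q)))"
          using C q phi_nonneg by (intro mult_left_mono divide_right_mono) auto
        finally show ?thesis using h(2)[of n] by (simp add: divide_le_eq)
      qed
      then show "norm (indicator {..t} r *\<^sub>R (remainder \<eta> (h n) r / norm (h n - \<eta>)))
          \<le> indicator {..t} r *\<^sub>R (\<phi> r * (2 * C / (1 - q)))"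
        using remainder_nonneg by (auto split: split_indicator)
    qed
  qed measurable
  then show ?thesis
    by (simp add: set_lebesgue_integral_def)
qed

lemma G_deriv: "(G has_derivative (*v) (Zinf \<eta>)) (at \<eta>)"
  unfolding has_derivative_within
proof
  obtain c where c: "0 < c" "\<And>x. norm x \<le> c * N x" using norm_le_N by blast
  show "((\<lambda>y. (1 / norm (y - \<eta>)) *\<^sub>R (G y - (G \<eta> + Zinf \<eta> *v (y - \<eta>)))) \<longlongrightarrow> 0) (at \<eta>)"
    unfolding tendsto_at_iff_sequentially o_def
  proof (intro allI impI)
    fix h :: "nat \<Rightarrow> real^'n" assume "\<forall>i. h i \<in> UNIV - {\<eta>}" and lim: "h \<longlonglongrightarrow> \<eta>"
    then have ne: "\<And>i. h i \<noteq> \<eta>" by auto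
    show "(\<lambda>n. (1 / norm (h n - \<eta>)) *\<^sub>R (G (h n) - (G \<eta> + Zinf \<eta> *v (h n - \<eta>)))) \<longlonglongrightarrow> 0"
    proof (rule Lim_null_comparison)
      let ?I = "\<lambda>n. (LINT r:{..t}|lborel. remainder \<eta> (h n) r) / norm (h n - \<eta>)"
      show "(\<lambda>n. c / (1 - q) * ?I n) \<longlonglongrightarrow> 0"
        by (rule tendsto_mult_right_zero[OF remainder_integral_tendsto[OF lim ne]])
      have "norm (G (h n) - (G \<eta> + Zinf \<eta> *v (h n - \<eta>)))
          \<le> c * ((LINT r:{..t}|lborel. remainder \<eta> (h n) r) / (1 - q))" for n
        using c(2)[of "G (h n) - G \<eta> - Zinf \<eta> *v (h n - \<eta>)"] mult_left_mono[OF G_diff_le[of "h n" \<eta>], of c] c(1)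
        by (simp add: diff_diff_eq)
      then have "norm (G (h n) - (G \<eta> + Zinf \<eta> *v (h n - \<eta>))) / norm (h n - \<eta>)
          \<le> c * ((LINT r:{..t}|lborel. remainder \<eta> (h n) r) / (1 - q)) / norm (h n - \<eta>)" for n
        by (intro divide_right_mono) auto
      then show "\<forall>\<^sub>F n in sequentially. norm ((1 / norm (h n - \<eta>)) *\<^sub>R (G (h n) - (G \<eta> + Zinf \<eta> *v (h n - \<eta>))))
          \<le> c / (1 - q) * ?I n"
        by (intro always_eventually allI) simp
    qed
  qed
qed (rule matrix_vector_mul_bounded_linear)

end

section \<open>Second-order smoothness from the limit of the partial derivatives\<close>

lemma limit_in_C_at_botE:
  assumes "limit_in_C_at_bot H"
  obtains L where "continuous_on UNIV L" "\<And>C. compact C \<Longrightarrow> uniform_limit C H L at_bot"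
proof -
  obtain L where L: "\<And>C. compact C \<Longrightarrow> uniform_limit C H L at_bot"
    using assms unfolding limit_in_C_at_bot_def by blast
  \<comment> \<open>\<open>limit_in_C_at_bot\<close> does not assert continuity of the limit;
    uniform convergence on closed unit balls yields it locally.\<close>
  have cont: "continuous_on (cball x 1) L" for x
  proof (rule uniform_limit_theorem)
    show "\<forall>\<^sub>F s in at_bot. continuous_on (cball x 1) (H s)"
      using assms unfolding limit_in_C_at_bot_def by (auto elim!: eventually_mono intro: continuous_on_subset)
  qed (use L in auto)
  have "isCont L x" for x
    by (rule continuous_on_interior[OF cont[of x]]) simp
  then have "continuous_on UNIV L" by (simp add: continuous_at_imp_continuous_on)
  then show ?thesis using L by (rule that)
qed

locale smooth_half_line_flow = half_line_flow N t \<phi> g Dg v Z b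
  for N :: "real^'n \<Rightarrow> real" and t \<phi> g Dg v Z b +
  assumes Z_partial: "\<And>j. \<forall>\<^sub>F s in at_bot. \<forall>\<eta>. has_partial j (\<lambda>\<eta>. Z \<eta> s) \<eta>"
    and Z_partial_limit:
      "\<And>i j. limit_in_C_at_bot (\<lambda>s \<eta>. partial_deriv j (\<lambda>\<eta>. Z \<eta> s) \<eta> *v axis i 1)"
begin

text \<open>Limit and derivative are interchanged along a coordinate segment, which is compact, so
  (D3) gives uniform convergence of the derivatives there.\<close>

lemma Zinf_partial:
  "\<exists>L. continuous_on UNIV L \<and>
     (\<forall>\<eta>. ((\<lambda>\<tau>. Zinf (\<eta> + \<tau> *\<^sub>R axis j 1) *v axis i 1) has_vector_derivative L \<eta>) (at 0))"
proof -
  let ?H = "\<lambda>s \<eta>. partial_deriv j (\<lambda>\<eta>. Z \<eta> s) \<eta> *v axis i 1"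
  obtain L where L: "continuous_on UNIV L" "\<And>C. compact C \<Longrightarrow> uniform_limit C ?H L at_bot"
    using limit_in_C_at_botE[OF Z_partial_limit] by blast
  obtain s0 where s0: "\<And>s \<eta>. s \<le> s0 \<Longrightarrow> has_partial j (\<lambda>\<eta>. Z \<eta> s) \<eta>"
    using Z_partial[of j] by (auto simp: eventually_at_bot_linorder)
  \<comment> \<open>Starting at \<open>s0\<close> makes the partial derivatives exist for every
    \<open>n\<close>, as differentiation of a sequence of functions requires, and not just
    eventually.\<close>
  define \<sigma> where "\<sigma> n = s0 - real n" for n
  have \<sigma>: "filterlim \<sigma> at_bot sequentially"
    unfolding \<sigma>_def filterlim_at_bot eventually_sequentially
  proof
    fix z
    obtain n0 where "s0 - z \<le> real n0" using real_arch_simple by blast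
    then show "\<exists>n0. \<forall>n\<ge>n0. s0 - real n \<le> z" by (intro exI[of _ n0]) force
  qed
  have "((\<lambda>\<tau>. Zinf (\<eta> + \<tau> *\<^sub>R axis j 1) *v axis i 1) has_vector_derivative L \<eta>) (at 0)" for \<eta>
  proof -
    let ?p = "\<lambda>\<tau>::real. \<eta> + \<tau> *\<^sub>R axis j 1"
    let ?f = "\<lambda>n \<tau>. Z (?p \<tau>) (\<sigma> n) *v axis i 1"
    have "\<exists>k. \<forall>\<tau>\<in>{-1..1}. (\<lambda>n. ?f n \<tau>) \<longlonglongrightarrow> k \<tau> \<and>
        (k has_derivative (\<lambda>d. d *\<^sub>R L (?p \<tau>))) (at \<tau> within {-1..1})"
    proof (rule has_derivative_sequence)
      fix n and \<tau> :: real
      have "(\<lambda>h. Z (?p \<tau> + h *\<^sub>R axis j 1) (\<sigma> n)) differentiable (at 0)"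
        using s0[of "\<sigma> n" "?p \<tau>"] by (simp add: has_partial_def \<sigma>_def)
      then have "((\<lambda>h. Z (?p \<tau> + h *\<^sub>R axis j 1) (\<sigma> n)) has_vector_derivative
          partial_deriv j (\<lambda>\<eta>. Z \<eta> (\<sigma> n)) (?p \<tau>)) (at 0)"
        unfolding partial_deriv_def by (simp add: vector_derivative_works)
      then have "((\<lambda>h. Z (?p (\<tau> + h)) (\<sigma> n)) has_vector_derivative
          partial_deriv j (\<lambda>\<eta>. Z \<eta> (\<sigma> n)) (?p \<tau>)) (at 0)"
        by (simp add: algebra_simps)
      then have "((\<lambda>\<tau>. Z (?p \<tau>) (\<sigma> n)) has_vector_derivative
          partial_deriv j (\<lambda>\<eta>. Z \<eta> (\<sigma> n)) (?p \<tau>)) (at \<tau>)"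
        by (rule has_vector_derivative_at_shift)
      then have "(?f n has_vector_derivative ?H (\<sigma> n) (?p \<tau>)) (at \<tau> within {-1..1})"
        by (rule has_vector_derivative_at_within[OF
            bounded_linear.has_vector_derivative[OF bounded_linear_matrix_vector_left]])
      then show "(?f n has_derivative (\<lambda>d. d *\<^sub>R ?H (\<sigma> n) (?p \<tau>))) (at \<tau> within {-1..1})"
        unfolding has_vector_derivative_def .
    next
      fix e :: real assume e: "0 < e"
      have "compact (?p ` {-1..1})"
        by (intro compact_continuous_image continuous_intros compact_Icc)
      from uniform_limitD[OF L(2)[OF this] e]
      have "\<forall>\<^sub>F n in sequentially. \<forall>x\<in>?p ` {-1..1}. dist (?H (\<sigma> n) x) (L x) < e"
        using \<sigma> by (rule eventually_compose_filterlim)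
      then show "\<forall>\<^sub>F n in sequentially. \<forall>\<tau>\<in>{-1..1}. \<forall>d.
          norm (d *\<^sub>R ?H (\<sigma> n) (?p \<tau>) - d *\<^sub>R L (?p \<tau>)) \<le> e * norm d"
      proof eventually_elim
        case (elim n)
        show ?case
        proof (intro ballI allI)
          fix \<tau> d :: real assume "\<tau> \<in> {-1..1}"
          then have "norm (?H (\<sigma> n) (?p \<tau>) - L (?p \<tau>)) \<le> e"
            using elim by (force simp: dist_norm)
          then show "norm (d *\<^sub>R ?H (\<sigma> n) (?p \<tau>) - d *\<^sub>R L (?p \<tau>)) \<le> e * norm d"
            unfolding scaleR_diff_right[symmetric] norm_scaleR real_norm_def mult.commute[of e]
            by (rule mult_left_mono) simp
        qed
      qed
    next
      show "(\<lambda>n. ?f n 0) \<longlonglongrightarrow> Zinf (?p 0) *v axis i 1"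
        by (intro tendsto_intros filterlim_compose[OF Z_tendsto \<sigma>])
    qed auto
    then obtain k where k: "\<forall>\<tau>\<in>{-1..1}. (\<lambda>n. ?f n \<tau>) \<longlonglongrightarrow> k \<tau> \<and>
        (k has_derivative (\<lambda>d. d *\<^sub>R L (?p \<tau>))) (at \<tau> within {-1..1})"
      by blast
    have "(k has_derivative (\<lambda>d. d *\<^sub>R L (?p 0))) (at 0 within {-1..1})"
      using k[rule_format, of 0] by simp
    then have der: "(k has_derivative (\<lambda>d. d *\<^sub>R L \<eta>)) (at 0)"
      by (simp add: at_within_Icc_at)
    have eq: "k \<tau> = Zinf (?p \<tau>) *v axis i 1" if "\<tau> \<in> {-1<..<1}" for \<tau>
    proof (rule LIMSEQ_unique)
      show "(\<lambda>n. ?f n \<tau>) \<longlonglongrightarrow> k \<tau>" using that k by simp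
      show "(\<lambda>n. ?f n \<tau>) \<longlonglongrightarrow> Zinf (?p \<tau>) *v axis i 1"
        by (intro tendsto_intros filterlim_compose[OF Z_tendsto \<sigma>])
    qed
    show ?thesis
      unfolding has_vector_derivative_def
      by (rule has_derivative_transform_within_open[OF der, of "{-1<..<1}"]) (auto simp: eq)
  qed
  then show ?thesis using L(1) by blast
qed

lemma C1_Zinf_column: "C1 (\<lambda>\<eta>. Zinf \<eta> *v axis i 1)"
proof -
  have "\<forall>b\<in>Basis. \<exists>L. continuous_on UNIV L \<and>
     (\<forall>\<eta>. ((\<lambda>\<tau>. Zinf (\<eta> + \<tau> *\<^sub>R b) *v axis i 1) has_vector_derivative L \<eta>) (at 0))"
    using Zinf_partial[of _ i] by (auto simp: Basis_vec_def)
  then obtain D where "\<And>b. b \<in> Basis \<Longrightarrow> continuous_on UNIV (D b)"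
    "\<And>b \<eta>. b \<in> Basis \<Longrightarrow>
      ((\<lambda>\<tau>. Zinf (\<eta> + \<tau> *\<^sub>R b) *v axis i 1) has_vector_derivative D b \<eta>) (at 0)"
    by metis
  then show ?thesis by (rule C1_partials[rotated])
qed

text \<open>The operator of \<open>Zinf \<eta>\<close>, written as a sum over columns so that
  \<open>C1_Zinf_column\<close> makes it \<open>C1\<close>.\<close>

definition GL :: "real^'n \<Rightarrow> (real^'n) \<Rightarrow>\<^sub>L (real^'n)" where
  "GL \<eta> = (\<Sum>i\<in>UNIV. rank_one (axis i 1) (Zinf \<eta> *v axis i 1))"

lemma GL_apply: "blinfun_apply (GL \<eta>) = (*v) (Zinf \<eta>)"
proof
  show "blinfun_apply (GL \<eta>) h = Zinf \<eta> *v h" for h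
    by (subst matrix_vector_mult_sum_axis) (simp add: GL_def blinfun.sum_left inner_axis)
qed

lemma C1_GL: "C1 GL"
  unfolding GL_def
  by (intro C1_sum C1_compose[OF C1_bounded_linear[OF bounded_linear_rank_one]] C1_Zinf_column)

lemma G_has_derivative_GL: "(G has_derivative blinfun_apply (GL \<eta>)) (at \<eta>)"
  unfolding GL_apply by (rule G_deriv)

lemma C2_G: "C2 G"
  by (rule C2I[OF G_has_derivative_GL C1_GL])

lemma continuous_on_G: "continuous_on S G"
  by (intro continuous_at_imp_continuous_on ballI has_derivative_continuous[OF G_deriv])

section \<open>Bijectivity and the inverse map\<close>

lemma surj_G: "surj G"
  unfolding surj_def
proof
  fix p
  obtain c where c: "0 < c" "\<And>x. norm x \<le> c * N x" using norm_le_N by blast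
  \<comment> \<open>A fixed point of \<open>\<lambda>\<eta>. p + (\<eta> - G \<eta>)\<close> is a
    preimage of \<open>p\<close>. The displacement is bounded by \<open>?R\<close> everywhere, so
    the ball of this radius about \<open>p\<close> is mapped into itself.\<close>
  let ?R = "c * (LINT r:{..t}|lborel. b r)"
  have bnd: "norm (\<eta> - G \<eta>) \<le> ?R" for \<eta>
  proof -
    have "N (\<eta> - G \<eta>) \<le> (LINT r:{..t}|lborel. N (g r (v r \<eta>)))"
      unfolding G_def using N_set_integral_le[OF integrable_gv] by simp
    also have "\<dots> \<le> (LINT r:{..t}|lborel. b r)"
      by (rule set_integral_mono[OF set_integrable_N[OF integrable_gv] b_int]) (simp add: g_bound)
    finally show ?thesis using c by (meson mult_left_mono less_imp_le order_trans)
  qed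
  obtain \<eta> where "p + (\<eta> - G \<eta>) = \<eta>"
  proof (rule brouwer[where S = "cball p ?R" and f = "\<lambda>\<eta>. p + (\<eta> - G \<eta>)"])
    show "cball p ?R \<noteq> {}" using order_trans[OF norm_ge_zero bnd] by simp
    show "continuous_on (cball p ?R) (\<lambda>\<eta>. p + (\<eta> - G \<eta>))"
      by (intro continuous_intros continuous_on_G)
    show "(\<lambda>\<eta>. p + (\<eta> - G \<eta>)) \<in> cball p ?R \<rightarrow> cball p ?R"
      using bnd by (simp add: dist_norm norm_minus_commute)
  qed auto
  then have "p = G \<eta>" by (simp add: algebra_simps)
  then show "\<exists>\<eta>. p = G \<eta>" ..
qed

lemma bij_G: "bij G"
  by (simp add: bij_def inj_G surj_G)

definition GL_inv :: "real^'n \<Rightarrow> (real^'n) \<Rightarrow>\<^sub>L (real^'n)" where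
  "GL_inv \<eta> = Blinfun ((*v) (matrix_inv (Zinf \<eta>)))"

lemma GL_inv: "GL_inv \<eta> o\<^sub>L GL \<eta> = id_blinfun" "GL \<eta> o\<^sub>L GL_inv \<eta> = id_blinfun"
proof -
  have "invertible (Zinf \<eta>)" using det_Zinf_pos[of \<eta>] by (simp add: invertible_det_nz)
  then show "GL_inv \<eta> o\<^sub>L GL \<eta> = id_blinfun" "GL \<eta> o\<^sub>L GL_inv \<eta> = id_blinfun"
    by (auto intro!: blinfun_eqI simp: GL_apply GL_inv_def bounded_linear_Blinfun_apply
        matrix_vector_mul_bounded_linear matrix_vector_mul_assoc matrix_inv_cancel)
qed

lemma inv_G_has_derivative: "(inv G has_derivative blinfun_apply (GL_inv (inv G y))) (at y)"
proof (rule has_derivative_inverse_strong_x[where S = UNIV])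
  show "(G has_derivative blinfun_apply (GL (inv G y))) (at (inv G y))"
    by (rule G_has_derivative_GL)
  show "blinfun_apply (GL (inv G y)) \<circ> blinfun_apply (GL_inv (inv G y)) = id"
    using arg_cong[OF GL_inv(2)[of "inv G y"], of blinfun_apply]
    by (simp add: fun_eq_iff blinfun_compose.rep_eq)
qed (auto simp: continuous_on_G inv_f_f[OF inj_G] surj_f_inv_f[OF surj_G])

text \<open>A bootstrap on the formula for the derivative of \<open>inv G\<close>, namely
  \<open>GL_inv\<close> at \<open>inv G y\<close>: continuity of \<open>inv G\<close> makes it
  continuous, hence \<open>inv G\<close> is \<open>C1\<close>, hence the derivative itself is
  \<open>C1\<close>.\<close>

lemma C2_inv_G: "C2 (inv G)"
proof -
  have cont: "continuous_on UNIV (inv G)"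
    by (intro continuous_at_imp_continuous_on ballI has_derivative_continuous[OF inv_G_has_derivative])
  have contA: "isCont (\<lambda>y. GL (inv G y)) y" for y
    using continuous_on_compose2[OF C1_continuous[OF C1_GL] cont]
    by (simp add: continuous_on_eq_continuous_at)
  have assoc: "(u o\<^sub>L v) o\<^sub>L w = u o\<^sub>L (v o\<^sub>L w)" for u v w :: "(real^'n) \<Rightarrow>\<^sub>L (real^'n)"
    by (rule blinfun_eqI) simp
  have unit: "id_blinfun o\<^sub>L u = u" "u o\<^sub>L id_blinfun = u" for u :: "(real^'n) \<Rightarrow>\<^sub>L (real^'n)"
    by (auto intro: blinfun_eqI)
  note inv_family = bounded_bilinear_blinfun_compose assoc unit
  have "isCont (\<lambda>y. GL_inv (inv G y)) y" for y
    using contA by (rule isCont_inverse_family[OF inv_family GL_inv])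
  then have "C1 (inv G)"
    by (intro C1I[OF inv_G_has_derivative]) (simp add: continuous_at_imp_continuous_on)
  then have "C1 (\<lambda>y. GL (inv G y))"
    by (rule C1_compose[OF C1_GL])
  then have "C1 (\<lambda>y. GL_inv (inv G y))"
    by (rule C1_inverse_family[OF inv_family GL_inv])
  then show ?thesis by (rule C2I[OF inv_G_has_derivative])
qed

theorem C2_diffeomorphism_G: "C2_diffeomorphism G"
  by (simp add: C2_diffeomorphism_def bij_G C2_G C2_inv_G)

theorem orientation_preserving_G: "orientation_preserving G"
  unfolding orientation_preserving_def jacobian_def frechet_derivative_at[OF G_deriv, symmetric]
  using det_Zinf_pos G_deriv by (auto simp: differentiable_def)

end

section \<open>Reduction of the nonlinear system\<close>

lemma set_integrable_exp_at_bot: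
  fixes \<alpha> t :: real
  assumes "0 < \<alpha>"
  shows "set_integrable lborel {..t} (\<lambda>r. exp (- \<alpha> * (t - r)))"
proof -
  have "(\<lambda>x. exp (- \<alpha> * x)) integrable_on {0..}"
    using assms by (rule integrable_on_exp_minus_to_infinity)
  then have "set_integrable lebesgue {0..} (\<lambda>x. exp (- \<alpha> * x))"
    by (intro nonnegative_absolutely_integrable_1) auto
  then have "integrable lborel (\<lambda>x. indicator {0..} x *\<^sub>R exp (- \<alpha> * x))"
    unfolding set_integrable_def by (subst (asm) integrable_completion) auto
  then have "integrable lborel (\<lambda>x. indicator {0..} (t + -1 * x) *\<^sub>R exp (- \<alpha> * (t + -1 * x)))"
    by (rule lborel_integrable_real_affine) simp
  moreover have "indicator {0..} (t + -1 * x) = (indicator {..t} x :: real)" for x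
    by (simp add: indicator_def)
  ultimately show ?thesis by (simp add: set_integrable_def)
qed

text \<open>The squared norm times \<open>exp (- 2 * L * r)\<close> decreases and times
  \<open>exp (2 * L * r)\<close> increases, so a zero propagates in both time directions.\<close>

lemma ode_zero_unique:
  fixes w :: "real \<Rightarrow> 'a::real_inner"
  assumes w: "\<And>r. (w has_vector_derivative w' r) (at r)"
    and le: "\<And>r. a \<le> r \<Longrightarrow> r \<le> b \<Longrightarrow> norm (w' r) \<le> L * norm (w r)" and ab: "a \<le> b"
  shows "w a = 0 \<longleftrightarrow> w b = 0"
proof -
  have d: "((\<lambda>r. exp (c * r) * (w r \<bullet> w r)) has_real_derivative
      exp (c * r) * (c * (w r \<bullet> w r) + 2 * (w r \<bullet> w' r))) (at r)" for c r
  proof -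
    have "((\<lambda>r. w r \<bullet> w r) has_real_derivative 2 * (w r \<bullet> w' r)) (at r)"
      using bounded_bilinear.has_vector_derivative[OF bounded_bilinear_inner w w, of r]
      by (simp add: has_real_derivative_iff_has_vector_derivative inner_commute)
    then show ?thesis
      by (auto intro!: derivative_eq_intros simp: algebra_simps)
  qed
  have abs: "\<bar>w r \<bullet> w' r\<bar> \<le> L * (w r \<bullet> w r)" if "a \<le> r" "r \<le> b" for r
  proof -
    have "\<bar>w r \<bullet> w' r\<bar> \<le> norm (w r) * norm (w' r)" by (rule Cauchy_Schwarz_ineq2)
    also have "\<dots> \<le> norm (w r) * (L * norm (w r))" using le[OF that] by (intro mult_left_mono) auto
    finally show ?thesis by (simp add: dot_square_norm power2_eq_square algebra_simps)
  qed
  have "exp (- 2 * L * b) * (w b \<bullet> w b) \<le> exp (- 2 * L * a) * (w a \<bullet> w a)"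
  proof (rule DERIV_nonpos_imp_nonincreasing[OF ab])
    fix r assume "a \<le> r" "r \<le> b"
    then have "- 2 * L * (w r \<bullet> w r) + 2 * (w r \<bullet> w' r) \<le> 0" using abs[of r] by simp
    then show "\<exists>D. ((\<lambda>r. exp (- 2 * L * r) * (w r \<bullet> w r)) has_real_derivative D) (at r) \<and> D \<le> 0"
      using d[of "- 2 * L" r] by (auto intro!: exI mult_nonneg_nonpos)
  qed
  moreover have "exp (2 * L * a) * (w a \<bullet> w a) \<le> exp (2 * L * b) * (w b \<bullet> w b)"
  proof (rule DERIV_nonneg_imp_nondecreasing[OF ab])
    fix r assume "a \<le> r" "r \<le> b"
    then have "0 \<le> 2 * L * (w r \<bullet> w r) + 2 * (w r \<bullet> w' r)" using abs[of r] by simp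
    then show "\<exists>D. ((\<lambda>r. exp (2 * L * r) * (w r \<bullet> w r)) has_real_derivative D) (at r) \<and> 0 \<le> D"
      using d[of "2 * L" r] by (auto intro!: exI mult_nonneg_nonneg)
  qed
  ultimately show ?thesis
    by (auto simp: mult_le_0_iff inner_ge_zero[THEN antisym_conv])
qed

section \<open>Transition matrices and removal of the linear part\<close>

context
  fixes A \<Phi> :: "real \<Rightarrow> real^'n^'n"
  assumes \<Phi>: "fundamental_matrix A \<Phi>"
begin

lemma matrix_inv_fundamental:
  "matrix_inv (\<Phi> r) ** \<Phi> r = mat 1" "\<Phi> r ** matrix_inv (\<Phi> r) = mat 1"
  using \<Phi> matrix_inv_cancel unfolding fundamental_matrix_def by blast+

lemma matrix_inv_fundamental_derivative:
  "((\<lambda>r. matrix_inv (\<Phi> r)) has_vector_derivative - (matrix_inv (\<Phi> r) ** A r)) (at r)"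
proof -
  have "(\<Phi> has_derivative (\<lambda>h. h *\<^sub>R (A r ** \<Phi> r))) (at r)"
    using \<Phi> unfolding fundamental_matrix_def has_vector_derivative_def by blast
  from has_derivative_inverse_family[OF bounded_bilinear_matrix_mult _ _ _ _ _ this,
      where e = "mat 1" and B = "\<lambda>r. matrix_inv (\<Phi> r)"]
  have "((\<lambda>r. matrix_inv (\<Phi> r)) has_derivative
      (\<lambda>h. - (matrix_inv (\<Phi> r) ** (h *\<^sub>R (A r ** \<Phi> r)) ** matrix_inv (\<Phi> r)))) (at r)"
    by (simp add: matrix_mul_assoc matrix_inv_fundamental)
  moreover have "matrix_inv (\<Phi> r) ** (h *\<^sub>R (A r ** \<Phi> r)) ** matrix_inv (\<Phi> r)
      = h *\<^sub>R (matrix_inv (\<Phi> r) ** A r)" for h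
  proof -
    have "matrix_inv (\<Phi> r) ** (h *\<^sub>R (A r ** \<Phi> r)) ** matrix_inv (\<Phi> r)
        = h *\<^sub>R (matrix_inv (\<Phi> r) ** A r ** (\<Phi> r ** matrix_inv (\<Phi> r)))"
      by (simp add: bounded_bilinear.scaleR_left[OF bounded_bilinear_matrix_mult]
          bounded_bilinear.scaleR_right[OF bounded_bilinear_matrix_mult] matrix_mul_assoc)
    then show ?thesis by (simp add: matrix_inv_fundamental)
  qed
  ultimately show ?thesis by (simp add: has_vector_derivative_def)
qed

lemma transition_matrix_cancel: "transition_matrix \<Phi> t r ** transition_matrix \<Phi> r t = mat 1"
proof -
  have "transition_matrix \<Phi> t r ** transition_matrix \<Phi> r t
      = \<Phi> t ** (matrix_inv (\<Phi> r) ** \<Phi> r) ** matrix_inv (\<Phi> t)"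
    by (simp add: transition_matrix_def matrix_mul_assoc)
  then show ?thesis by (simp add: matrix_inv_fundamental)
qed

lemma transition_matrix_cancel_vector:
  "transition_matrix \<Phi> t r *v (transition_matrix \<Phi> r t *v x) = x"
  by (simp add: matrix_vector_mul_assoc transition_matrix_cancel)

lemma transition_matrix_self: "transition_matrix \<Phi> t t = mat 1"
  by (simp add: transition_matrix_def matrix_inv_fundamental)

lemma continuous_on_transition_matrix:
  "continuous_on S (transition_matrix \<Phi> t)" "continuous_on S (\<lambda>r. transition_matrix \<Phi> r t)"
proof -
  have 1: "continuous_on S \<Phi>"
    using \<Phi> unfolding fundamental_matrix_def
    by (meson continuous_at_imp_continuous_on has_vector_derivative_continuous)
  have 2: "continuous_on S (\<lambda>r. matrix_inv (\<Phi> r))"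
    by (intro continuous_at_imp_continuous_on ballI
        has_vector_derivative_continuous[OF matrix_inv_fundamental_derivative])
  note cont = bounded_bilinear.continuous_on[OF bounded_bilinear_matrix_mult]
  show "continuous_on S (transition_matrix \<Phi> t)" "continuous_on S (\<lambda>r. transition_matrix \<Phi> r t)"
    unfolding transition_matrix_def[abs_def] by (intro cont 1 2 continuous_on_const)+
qed

text \<open>The term \<open>A r *v p r\<close> cancels against the derivative of
  \<open>matrix_inv (\<Phi> r)\<close>, leaving only the transported inhomogeneity.\<close>

lemma transition_matrix_variation_of_constants:
  assumes "(p has_vector_derivative A r *v p r + k) (at r)"
  shows "((\<lambda>r. transition_matrix \<Phi> t r *v p r) has_vector_derivative transition_matrix \<Phi> t r *v k) (at r)"
proof -
  note bounded_bilinear.has_vector_derivative[OF bounded_bilinear_matrix_vector_mult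
      matrix_inv_fundamental_derivative assms]
  then have "((\<lambda>r. matrix_inv (\<Phi> r) *v p r) has_vector_derivative matrix_inv (\<Phi> r) *v k) (at r)"
    by (rule has_vector_derivative_eq_rhs)
      (simp add: matrix_vector_right_distrib matrix_vector_mul_assoc
        bounded_bilinear.minus_left[OF bounded_bilinear_matrix_vector_mult])
  from bounded_linear.has_vector_derivative[OF matrix_vector_mul_bounded_linear[of "\<Phi> t"] this]
  show ?thesis by (simp add: transition_matrix_def matrix_vector_mul_assoc)
qed

end

text \<open>Uniqueness for a Lipschitz right-hand side. It shows that solutions issued at one fixed
  time pass through every point at any other time, as is needed to interpret the supremum over
  \<open>\<xi>\<close> in (D1).\<close>

lemma (in norm_on_Rn) general_solution_surj:
  assumes A: "continuous_on UNIV A" and y: "general_solution A f y"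
    and lip: "\<And>t x x'. N (f t x - f t x') \<le> \<gamma> * N (x - x')"
  shows "y r \<tau> (y \<tau> r p) = p"
proof -
  obtain C where C: "0 < C" "\<And>x. N x \<le> C * norm x" using N_le_norm by blast
  obtain c where c: "0 < c" "\<And>x. norm x \<le> c * N x" using norm_le_N by blast
  obtain k where k: "0 < k" "\<And>(B::real^'n^'n) x. norm (B *v x) \<le> norm B * norm x * k"
    using bounded_bilinear.pos_bounded[OF bounded_bilinear_matrix_vector_mult] by blast
  \<comment> \<open>The two times come in either order, so uniqueness is used on the interval
    between them.\<close>
  let ?I = "{min r \<tau>..max r \<tau>}"
  have "compact (A ` ?I)"
    by (intro compact_continuous_image continuous_on_subset[OF A] compact_Icc) auto
  then obtain B where B: "\<And>s. s \<in> ?I \<Longrightarrow> norm (A s) \<le> B"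
    by (meson bounded_iff compact_imp_bounded imageI)
  let ?y1 = "\<lambda>s. y s \<tau> (y \<tau> r p)" and ?y2 = "\<lambda>s. y s r p"
  let ?w = "\<lambda>s. ?y1 s - ?y2 s"
  have "?w (min r \<tau>) = 0 \<longleftrightarrow> ?w (max r \<tau>) = 0"
  proof (rule ode_zero_unique)
    show "(?w has_vector_derivative A s *v ?w s + (f s (?y1 s) - f s (?y2 s))) (at s)" for s
    proof -
      have "(?y1 has_vector_derivative A s *v ?y1 s + f s (?y1 s)) (at s)"
        "(?y2 has_vector_derivative A s *v ?y2 s + f s (?y2 s)) (at s)"
        using y unfolding general_solution_def by blast+
      from has_vector_derivative_diff[OF this] show ?thesis
        by (rule has_vector_derivative_eq_rhs) (simp add: matrix_vector_mult_diff_distrib)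
    qed
    fix s assume s: "min r \<tau> \<le> s" "s \<le> max r \<tau>"
    have "norm (A s *v ?w s) \<le> norm (A s) * norm (?w s) * k" by (rule k)
    also have "\<dots> \<le> B * norm (?w s) * k"
      using B[of s] s k(1) by (intro mult_right_mono) auto
    finally have 1: "norm (A s *v ?w s) \<le> B * norm (?w s) * k" .
    have "norm (f s (?y1 s) - f s (?y2 s)) \<le> c * N (f s (?y1 s) - f s (?y2 s))" by (rule c)
    also have "\<dots> \<le> c * (\<bar>\<gamma>\<bar> * N (?w s))"
      using lip[of s "?y1 s" "?y2 s"] c(1) mult_right_mono[OF abs_ge_self[of \<gamma>] N_nonneg[of "?w s"]]
      by (intro mult_left_mono) auto
    also have "\<dots> \<le> c * (\<bar>\<gamma>\<bar> * (C * norm (?w s)))"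
      using c(1) C by (intro mult_left_mono) auto
    finally have 2: "norm (f s (?y1 s) - f s (?y2 s)) \<le> c * (\<bar>\<gamma>\<bar> * (C * norm (?w s)))" .
    show "norm (A s *v ?w s + (f s (?y1 s) - f s (?y2 s))) \<le> (B * k + c * \<bar>\<gamma>\<bar> * C) * norm (?w s)"
      using norm_triangle_le[OF add_mono[OF 1 2]] by (simp add: algebra_simps)
  qed simp
  moreover have "?w \<tau> = 0" using y by (simp add: general_solution_def)
  ultimately have "?w r = 0" by (auto simp: min_def max_def split: if_splits)
  then show ?thesis using y by (simp add: general_solution_def)
qed

context norm_on_Rn
begin

text \<open>Using the least Lipschitz constant, a supremum of continuous functions of the time, in place of
  the supremum of the derivative norms in the hypothesis makes the contraction weight measurable.\<close>

definition lipschitz_modulus :: "(real^'n \<Rightarrow> real^'n) \<Rightarrow> ennreal" where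
  "lipschitz_modulus k = (SUP p. ennreal (N (k (fst p) - k (snd p)) / N (fst p - snd p)))"

lemma lipschitz_modulus_bound:
  assumes "lipschitz_modulus k < top"
  shows "N (k x - k x') \<le> enn2real (lipschitz_modulus k) * N (x - x')"
proof (cases "x = x'")
  case False
  then have "0 < N (x - x')" by (simp add: N_pos)
  have "ennreal (N (k x - k x') / N (x - x')) \<le> lipschitz_modulus k"
    unfolding lipschitz_modulus_def by (rule SUP_upper2[of "(x, x')"]) auto
  then have "N (k x - k x') / N (x - x') \<le> enn2real (lipschitz_modulus k)"
    using enn2real_mono[OF _ assms] by fastforce
  then show ?thesis using \<open>0 < N (x - x')\<close> by (simp add: divide_le_eq)
qed simp

lemma lipschitz_modulus_le:
  assumes "\<And>x x'. N (k x - k x') \<le> c * N (x - x')" "0 \<le> c"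
  shows "lipschitz_modulus k \<le> ennreal c"
  unfolding lipschitz_modulus_def
proof (rule SUP_least, rule ennreal_leI)
  \<comment> \<open>On the diagonal the quotient is \<open>0 / 0 = 0\<close>, which is where
    \<open>0 \<le> c\<close> enters.\<close>
  show "N (k (fst p) - k (snd p)) / N (fst p - snd p) \<le> c" for p
    using assms by (cases "fst p = snd p") (simp_all add: divide_le_eq N_pos)
qed

text \<open>A supremum of continuous functions is lower semicontinuous: its superlevel sets are
  unions of open sets, so the uncountable index set does no harm.\<close>

lemma measurable_lipschitz_modulus:
  assumes "\<And>x. continuous_on UNIV (\<lambda>r. g r x)"
  shows "(\<lambda>r::real. lipschitz_modulus (g r)) \<in> borel_measurable borel"
proof (rule borel_measurableI_greater)
  fix c :: ennreal
  have "{r. c < lipschitz_modulus (g r)}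
      = (\<Union>p. {r. c < ennreal (N (g r (fst p) - g r (snd p)) / N (fst p - snd p))})"
    unfolding lipschitz_modulus_def less_SUP_iff by blast
  moreover have "open {r. c < ennreal (N (g r (fst p) - g r (snd p)) / N (fst p - snd p))}" for p
    unfolding divide_inverse by (intro open_Collect_less continuous_intros continuous_on_ennreal assms)
  ultimately show "{r \<in> space borel. c < lipschitz_modulus (g r)} \<in> sets borel"
    by (simp add: open_UN borel_open)
qed

end

theorem theorem2p2:
  fixes N :: "real^'n \<Rightarrow> real"
    and A \<Phi> :: "real \<Rightarrow> real^'n^'n"
    and f :: "real \<Rightarrow> real^'n \<Rightarrow> real^'n"
    and X :: "real \<Rightarrow> real \<Rightarrow> real^'n^'n"
    and y :: "real \<Rightarrow> real \<Rightarrow> real^'n \<Rightarrow> real^'n"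
    and Z :: "real \<Rightarrow> real^'n \<Rightarrow> real \<Rightarrow> real^'n^'n"
    and M \<mu> \<gamma> K \<alpha> :: real
  assumes norm: "vector_norm N"
    and A_cont: "continuous_on UNIV A"
    and f_cont: "continuous_on UNIV (\<lambda>(t, x). f t x)"
    and \<Phi>: "fundamental_matrix A \<Phi>"
    and X: "X = transition_matrix \<Phi>"
    and y: "general_solution A f y"
    and A1: "bdd_above (range (\<lambda>t. op_norm N (A t)))" "(SUP t. op_norm N (A t)) = M"
    and A2: "0 < \<mu>" "\<forall>t x. N (f t x) \<le> \<mu>"
    and A3: "0 < \<gamma>" "\<forall>t x x'. N (f t x - f t x') \<le> \<gamma> * N (x - x')"
    and A4: "0 < K" "0 < \<alpha>" "\<forall>t s. s \<le> t \<longrightarrow> op_norm N (X t s) \<le> K * exp (- \<alpha> * (t - s))"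
      "2 * K * \<gamma> < \<alpha>"
    and D1: "\<forall>t. C2 (f t)"
      "\<forall>t. (\<integral>\<^sup>+r\<in>{..t}. (SUP \<xi>. ennreal (op_norm N (X t r ** Dy f r (y r 0 \<xi>) ** X r t))) \<partial>lborel) < 1"
    and D2: "\<forall>t \<xi>. extended_integral {..t} (\<lambda>r. trace (Dy f r (y r t \<xi>))) < \<infinity>"
    and Z: "\<forall>t \<eta>. Z t \<eta> t = mat 1 \<and>
      fundamental_matrix_int (\<lambda>s. X t s ** Dy f s (y s t \<eta>) ** X s t) (Z t \<eta>)"
    and D3: "\<forall>t i j. (\<forall>\<^sub>F s in at_bot. \<forall>\<eta>. has_partial j (\<lambda>\<eta>. Z t \<eta> s) \<eta>) \<and>
      limit_in_C_at_bot (\<lambda>s \<eta>. partial_deriv j (\<lambda>\<eta>. Z t \<eta> s) \<eta> *v axis i 1)"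
  shows "\<forall>t. C2_diffeomorphism (linearizing_map X f y t) \<and>
             orientation_preserving (linearizing_map X f y t)"
proof
  fix t :: real
  interpret norm_on_Rn N by unfold_locales (rule norm)
  define g where "g r x = X t r *v f r (X r t *v x)" for r x
  define Dg where "Dg r x = X t r ** Dy f r (X r t *v x) ** X r t" for r x
  define v where "v r \<eta> = X t r *v y r t \<eta>" for r \<eta>
  define \<phi> where "\<phi> r = enn2real (lipschitz_modulus (g r))" for r
  define b where "b r = K * \<mu> * exp (- \<alpha> * (t - r))" for r
  have cancel: "X r s *v (X s r *v x) = x" for r s x
    unfolding X by (rule transition_matrix_cancel_vector[OF \<Phi>])
  have X_cont: "continuous_on S (X t)" "continuous_on S (\<lambda>r. X r t)" for S
    unfolding X by (rule continuous_on_transition_matrix[OF \<Phi>])+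
  have g_deriv: "(g r has_derivative (*v) (Dg r x)) (at x)" for r x
  proof -
    have "f r differentiable (at z)" for z
      using D1(1) unfolding C2_def differentiable_def by blast
    then have Dy: "(f r has_derivative (*v) (Dy f r z)) (at z)" for z
      unfolding Dy_def jacobian_works by simp
    have "((\<lambda>x. f r (X r t *v x)) has_derivative (\<lambda>h. Dy f r (X r t *v x) *v (X r t *v h))) (at x)"
      by (rule has_derivative_compose[OF
            bounded_linear_imp_has_derivative[OF matrix_vector_mul_bounded_linear] Dy])
    then have "(g r has_derivative (\<lambda>h. X t r *v (Dy f r (X r t *v x) *v (X r t *v h)))) (at x)"
      unfolding g_def[abs_def]
      by (rule bounded_linear.has_derivative[OF matrix_vector_mul_bounded_linear])
    then show ?thesis
      by (rule has_derivative_eq_rhs) (simp add: fun_eq_iff Dg_def matrix_vector_mul_assoc matrix_mul_assoc)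
  qed
  have g_cont: "continuous_on UNIV (\<lambda>(r, x). g r x)"
  proof -
    have 1: "continuous_on UNIV (\<lambda>p::real \<times> (real^'n). X (fst p) t *v snd p)"
      by (intro continuous_intros continuous_on_compose2[OF X_cont(2)]) auto
    have "continuous_on UNIV (\<lambda>p::real \<times> (real^'n). f (fst p) (X (fst p) t *v snd p))"
      using continuous_on_compose2[OF f_cont continuous_on_Pair[OF continuous_on_fst[OF continuous_on_id] 1]]
      by simp
    then have "continuous_on UNIV (\<lambda>p::real \<times> (real^'n). X t (fst p) *v f (fst p) (X (fst p) t *v snd p))"
      by (intro continuous_intros continuous_on_compose2[OF X_cont(1)]) auto
    then show ?thesis by (simp add: g_def case_prod_unfold)
  qed
  have measurable_modulus [measurable]: "(\<lambda>r. lipschitz_modulus (g r)) \<in> borel_measurable borel"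
    using continuous_on_compose2[OF g_cont, of UNIV "\<lambda>r. (r, x)" for x]
    by (intro measurable_lipschitz_modulus) (simp add: continuous_on_Pair)
  \<comment> \<open>By the mean value inequality the Lipschitz constant is at most the supremum of
    the norms of \<open>Dg r x\<close> over all \<open>x\<close>, and every
    \<open>X r t *v x\<close> is of the form \<open>y r 0 \<xi>\<close>. An infinite supremum is
    trivial and is set aside.\<close>
  have modulus_le: "lipschitz_modulus (g r)
      \<le> (SUP \<xi>. ennreal (op_norm N (X t r ** Dy f r (y r 0 \<xi>) ** X r t)))" (is "_ \<le> ?S r") for r
  proof -
    define S where "S = ?S r"
    have "lipschitz_modulus (g r) \<le> S"
    proof (cases "S = top")
      case False
      then have S: "ennreal (enn2real S) = S" by (simp add: less_top)
      have "op_norm N (Dg r x) \<le> enn2real S" for x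
      proof -
        \<comment> \<open>The required \<open>\<xi>\<close> is the value at time 0 of the solution
          through \<open>X r t *v x\<close> at time \<open>r\<close>.\<close>
        have "y r 0 (y 0 r (X r t *v x)) = X r t *v x"
          by (rule general_solution_surj[OF A_cont y A3(2)[rule_format]])
        then have "ennreal (op_norm N (Dg r x)) \<le> S"
          unfolding Dg_def S_def by (intro SUP_upper2[of "y 0 r (X r t *v x)"]) auto
        then have "ennreal (op_norm N (Dg r x)) \<le> ennreal (enn2real S)"
          unfolding S .
        then show ?thesis by (subst (asm) ennreal_le_iff) auto
      qed
      then have "N (Dg r x *v h) \<le> enn2real S * N h" for x h
        by (meson N_matrix_vector_le N_nonneg mult_right_mono order_trans)
      then have "N (g r x - g r x') \<le> enn2real S * N (x - x')" for x x'
        by (rule N_mvt[OF g_deriv])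
      then have "lipschitz_modulus (g r) \<le> ennreal (enn2real S)"
        by (rule lipschitz_modulus_le) simp
      then show ?thesis unfolding S .
    qed simp
    then show ?thesis unfolding S_def .
  qed
  \<comment> \<open>(D1) could give finiteness only almost everywhere, while \<open>\<phi>\<close>
    must be a Lipschitz constant at every time; (A3) closes the gap.\<close>
  have modulus_finite: "lipschitz_modulus (g r) < top" for r
  proof -
    let ?c = "\<bar>op_norm N (X t r)\<bar> * (\<gamma> * \<bar>op_norm N (X r t)\<bar>)"
    have op: "N (B *v x) \<le> \<bar>op_norm N B\<bar> * N x" for B x
      using N_matrix_vector_le[of B x] mult_right_mono[OF abs_ge_self N_nonneg] by (rule order_trans)
    have "N (g r x - g r x') \<le> ?c * N (x - x')" for x x'
    proof -
      have "N (g r x - g r x') \<le> \<bar>op_norm N (X t r)\<bar> * N (f r (X r t *v x) - f r (X r t *v x'))"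
        unfolding g_def matrix_vector_mult_diff_distrib[symmetric] by (rule op)
      also have "\<dots> \<le> \<bar>op_norm N (X t r)\<bar> * (\<gamma> * N (X r t *v (x - x')))"
        using A3(2) by (intro mult_left_mono) (auto simp: matrix_vector_mult_diff_distrib)
      also have "\<dots> \<le> \<bar>op_norm N (X t r)\<bar> * (\<gamma> * (\<bar>op_norm N (X r t)\<bar> * N (x - x')))"
        using A3(1) op by (intro mult_left_mono) auto
      finally show ?thesis by (simp add: mult.assoc)
    qed
    then have "lipschitz_modulus (g r) \<le> ennreal ?c"
      using A3(1) by (intro lipschitz_modulus_le) auto
    then show ?thesis using ennreal_less_top le_less_trans by blast
  qed
  have ennreal_phi: "ennreal (\<phi> r) = lipschitz_modulus (g r)" for r
    unfolding \<phi>_def using modulus_finite by simp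
  have "(\<integral>\<^sup>+r. ennreal (indicator {..t} r *\<^sub>R \<phi> r) \<partial>lborel)
      = (\<integral>\<^sup>+r\<in>{..t}. lipschitz_modulus (g r) \<partial>lborel)"
    by (intro nn_integral_cong) (auto simp: ennreal_phi split: split_indicator)
  \<comment> \<open>Measurability of the supremum over \<open>\<xi>\<close> is not known, but the
    nonnegative integral is monotone for arbitrary functions.\<close>
  also have "\<dots> \<le> (\<integral>\<^sup>+r\<in>{..t}. (SUP \<xi>. ennreal (op_norm N (X t r ** Dy f r (y r 0 \<xi>) ** X r t))) \<partial>lborel)"
    by (intro nn_integral_mono mult_right_mono modulus_le) auto
  also have "\<dots> < 1" using D1(2) by blast
  finally have phi_nn: "(\<integral>\<^sup>+r. ennreal (indicator {..t} r *\<^sub>R \<phi> r) \<partial>lborel) < 1" .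
  have phi_meas [measurable]: "\<phi> \<in> borel_measurable borel"
    unfolding \<phi>_def[abs_def] by measurable
  have phi_int: "set_integrable lborel {..t} \<phi>"
    unfolding set_integrable_def
  proof (rule integrableI_nonneg)
    show "(\<integral>\<^sup>+r. ennreal (indicator {..t} r *\<^sub>R \<phi> r) \<partial>lborel) < \<infinity>"
      using phi_nn by (rule less_trans) simp
  qed (auto simp: \<phi>_def)
  have phi_lt1: "(LINT r:{..t}|lborel. \<phi> r) < 1"
  proof -
    have "ennreal (LINT r:{..t}|lborel. \<phi> r) < 1"
      unfolding set_lebesgue_integral_def using phi_int[unfolded set_integrable_def] phi_nn
      by (subst nn_integral_eq_integral[symmetric]) (auto simp: \<phi>_def)
    then show ?thesis by (simp add: ennreal_less_one_iff)
  qed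
  interpret smooth_half_line_flow N t \<phi> g Dg v "Z t" b
  proof
    show "0 \<le> \<phi> r" for r by (simp add: \<phi>_def)
    show "set_integrable lborel {..t} \<phi>" "(LINT r:{..t}|lborel. \<phi> r) < 1" by fact+
    show "continuous_on UNIV (\<lambda>(r, x). g r x)" by fact
    show "(g r has_derivative (*v) (Dg r x)) (at x)" for r x by fact
    show "N (g r x - g r x') \<le> \<phi> r * N (x - x')" for r x x'
      unfolding \<phi>_def using modulus_finite by (rule lipschitz_modulus_bound)
    show "N (g r x) \<le> b r" if "r \<le> t" for r x
    proof -
      have "N (g r x) \<le> op_norm N (X t r) * N (f r (X r t *v x))"
        unfolding g_def by (rule N_matrix_vector_le)
      also have "\<dots> \<le> K * exp (- \<alpha> * (t - r)) * \<mu>"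
        using A4(1,3) A2(2) that by (intro mult_mono) auto
      finally show ?thesis by (simp add: b_def algebra_simps)
    qed
    show "set_integrable lborel {..t} b"
      unfolding b_def[abs_def] using set_integrable_exp_at_bot[OF A4(2)] by simp
    show "((\<lambda>r. v r \<eta>) has_vector_derivative g r (v r \<eta>)) (at r)" for r \<eta>
      using y unfolding v_def g_def cancel unfolding X general_solution_def
      by (intro transition_matrix_variation_of_constants[OF \<Phi>]) blast
    show "v t \<eta> = \<eta>" for \<eta>
      using y by (simp add: v_def X transition_matrix_self[OF \<Phi>] general_solution_def)
    show "Z t \<eta> t = mat 1" for \<eta> using Z by blast
    show "fundamental_matrix_int (\<lambda>r. Dg r (v r \<eta>)) (Z t \<eta>)" for \<eta>
      using Z by (simp add: Dg_def v_def cancel)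
    show "\<forall>\<^sub>F s in at_bot. \<forall>\<eta>. has_partial j (\<lambda>\<eta>. Z t \<eta> s) \<eta>" for j using D3 by blast
    show "limit_in_C_at_bot (\<lambda>s \<eta>. partial_deriv j (\<lambda>\<eta>. Z t \<eta> s) \<eta> *v axis i 1)" for i j
      using D3 by blast
  qed
  have "linearizing_map X f y t = G"
    by (simp add: fun_eq_iff linearizing_map_def G_def g_def v_def cancel)
  then show "C2_diffeomorphism (linearizing_map X f y t) \<and>
      orientation_preserving (linearizing_map X f y t)"
    using C2_diffeomorphism_G orientation_preserving_G by simp
qed

end
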